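(* Let $\lambda\in\mathfrak h^*$ be a generic weight and $\mu=(\mu_1,\dots,\mu_r)\in(\mathbb C^* )^r$. The unique vector $|w\rangle$ in the completion of the Verma module $V_\lambda$ of $\mathfrak g$ such that $\langle\lambda|w\rangle=1$ and $e_i|w\rangle=\mu_i|w\rangle$ for all $i\in\{1,\dots,r\}$ is $$|w\rangle=\sum_{\beta\in Q_+}\Big(\prod_{i=1}^r (d_i\mu_i)^{\beta_i}\Big)\,|Z_\beta\rangle ,\qquad |Z_\beta\rangle=\sum_{\mathbf p\in\mathcal P_\beta}x(\mathbf p)\,|\mathbf p\rangle ,$$ where $\beta=\sum_i\beta_i\alpha_i$, and the path weights $x(\mathbf p)$ are computed from the vertex weight function $v(\beta)=(\lambda+\rho|\beta)-\frac12(\beta|\beta)$.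
   Context: Lie algebra data. $\mathfrak g=\mathfrak n_-\oplus\mathfrak h\oplus\mathfrak n_+$ is a finite-dimensional simple complex Lie algebra of rank $r$ with simple roots $\alpha_1,\dots,\alpha_r$, Cartan matrix $C$, and Chevalley generators $e_i\in\mathfrak n_+$, $f_i\in\mathfrak n_-$, $h_i\in\mathfrak h$ satisfying $[h_i,h_j]=0$, $[h_i,e_j]=C_{j,i}e_j$, $[h_i,f_j]=-C_{j,i}f_j$, $[e_i,f_j]=\delta_{i,j}h_j$ and, for $i\ne j$, $(\mathrm{ad}\,e_j)^{1-C_{i,j}}(e_i)=(\mathrm{ad}\,f_j)^{1-C_{i,j}}(f_i)=0$. The $d_i$ are the coprime positive integers with $C_{i,j}d_j=C_{j,i}d_i$. The co-roots $\alpha_i^\vee\in\mathfrak h^*$ are defined by $\alpha_i=d_i\alpha_i^\vee$, and $(\cdot|\cdot)$ is the symmetric bilinear form on $\mathfrak h^*$ with $(\alpha_i|\alpha_j^\vee)=C_{i,j}$. The value of $h_j$ on $\lambda\in\mathfrak h^*$ is $h_j(\lambda)=(\lambda|\alpha_j^\vee)$. Fundamental weights satisfy $(\omega_i|\alpha_j^\vee)=\delta_{i,j}$, and $\rho=\sum_{i=1}^r\omega_i$. $Q_+=\bigoplus_{i=1}^r\mathbb Z_{\ge0}\alpha_i$. Verma module. $V_\lambda=U(\mathfrak n_-)|\lambda\rangle$ is the Verma module with highest weight vector $|\lambda\rangle$ of weight $\lambda$; it is assumed irreducible. It is the direct sum of its finite-dimensional weight spaces $V[\lambda-\beta]$, $\beta\in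 Q_+$; its completion is $\prod_{\beta\in Q_+}V[\lambda-\beta]$. $\langle\lambda|$ is the linear functional equal to $1$ on $|\lambda\rangle$ and $0$ on $V[\lambda-\beta]$, $\beta\neq0$. Genericity. "$\lambda$ generic" means that $V_\lambda$ is irreducible and $v(\beta)\ne0$ for all $\beta\in Q_+\setminus\{0\}$, where $v(\beta)=(\lambda+\rho|\beta)-\frac12(\beta|\beta)$. Paths. For $\beta\in Q_+$, $\mathcal P_\beta$ is the (finite) set of sequences $\mathbf p=(p_0,p_1,\dots,p_N)$ in $Q_+$ with $p_0=0$, $p_N=\beta$ and each $p_k-p_{k-1}=\alpha_{i_k}$ a simple root. To $\mathbf p$ is associated the vector $|\mathbf p\rangle=f_{i_N}f_{i_{N-1}}\cdots f_{i_1}|\lambda\rangle\in V_\lambda$ and the weight $x(\mathbf p)=\prod_{k=1}^N\frac1{v(p_k)}$ (equal to $1$ for the trivial path $(0)$). *)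

theory Defs
  imports
    Complex_Main
    "HOL-Library.Function_Algebras"
    "HOL-Library.Poly_Mapping"
begin

section \<open>Lie algebras and Cartan subalgebras\<close>

locale lie_algebra = vector_space scale
  for scale :: "complex \<Rightarrow> 'g::ab_group_add \<Rightarrow> 'g" +
  fixes bracket :: "'g \<Rightarrow> 'g \<Rightarrow> 'g"
  assumes bracket_add_left: "bracket (x + y) z = bracket x z + bracket y z"
    and bracket_add_right: "bracket x (y + z) = bracket x y + bracket x z"
    and bracket_scale_left: "bracket (scale c x) y = scale c (bracket x y)"
    and bracket_scale_right: "bracket x (scale c y) = scale c (bracket x y)"
    and bracket_self: "bracket x x = 0"
    and jacobi: "bracket x (bracket y z) + bracket y (bracket z x) + bracket z (bracket x y) = 0"

definition finite_dim :: "(complex \<Rightarrow> 'a::ab_group_add \<Rightarrow> 'a) \<Rightarrow> bool" where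
  "finite_dim scale \<longleftrightarrow> (\<exists>B. finite B \<and> module.span scale B = UNIV)"

definition lie_ideal ::
    "(complex \<Rightarrow> 'g::ab_group_add \<Rightarrow> 'g) \<Rightarrow> ('g \<Rightarrow> 'g \<Rightarrow> 'g) \<Rightarrow> 'g set \<Rightarrow> bool" where
  "lie_ideal scale bracket I \<longleftrightarrow>
     module.subspace scale I \<and> (\<forall>x. \<forall>y\<in>I. bracket x y \<in> I)"

definition lie_subalgebra ::
    "(complex \<Rightarrow> 'g::ab_group_add \<Rightarrow> 'g) \<Rightarrow> ('g \<Rightarrow> 'g \<Rightarrow> 'g) \<Rightarrow> 'g set \<Rightarrow> bool" where
  "lie_subalgebra scale bracket S \<longleftrightarrow>
     module.subspace scale S \<and> (\<forall>x\<in>S. \<forall>y\<in>S. bracket x y \<in> S)"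

definition lie_simple ::
    "(complex \<Rightarrow> 'g::ab_group_add \<Rightarrow> 'g) \<Rightarrow> ('g \<Rightarrow> 'g \<Rightarrow> 'g) \<Rightarrow> bool" where
  "lie_simple scale bracket \<longleftrightarrow>
     (\<exists>x y. bracket x y \<noteq> 0) \<and>
     (\<forall>I. lie_ideal scale bracket I \<longrightarrow> I = {0} \<or> I = UNIV)"

text \<open>The dual of a subspace \<open>H\<close>: functionals on \<open>H\<close>, represented by functions on the whole
  space that vanish outside \<open>H\<close>, so that equality of functionals is equality of functions.\<close>

definition dual_of :: "(complex \<Rightarrow> 'g::ab_group_add \<Rightarrow> 'g) \<Rightarrow> 'g set \<Rightarrow> ('g \<Rightarrow> complex) set" where
  "dual_of scale H = {\<phi>.
     (\<forall>x\<in>H. \<forall>y\<in>H. \<phi> (x + y) = \<phi> x + \<phi> y) \<and>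
     (\<forall>c. \<forall>x\<in>H. \<phi> (scale c x) = c * \<phi> x) \<and>
     (\<forall>x. x \<notin> H \<longrightarrow> \<phi> x = 0)}"

definition fscale :: "complex \<Rightarrow> ('g \<Rightarrow> complex) \<Rightarrow> 'g \<Rightarrow> complex" where
  "fscale c \<phi> = (\<lambda>x. c * \<phi> x)"

definition root_space ::
    "(complex \<Rightarrow> 'g::ab_group_add \<Rightarrow> 'g) \<Rightarrow> ('g \<Rightarrow> 'g \<Rightarrow> 'g) \<Rightarrow> 'g set \<Rightarrow> ('g \<Rightarrow> complex) \<Rightarrow> 'g set" where
  "root_space scale bracket H \<phi> = {x. \<forall>t\<in>H. bracket t x = scale (\<phi> t) x}"

text \<open>For a finite-dimensional simple complex Lie algebra the Cartan subalgebras are exactly the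
  self-centralizing subspaces \<open>H\<close> (\<open>H = \<gg>\<^sub>0\<close>, which makes \<open>H\<close> an abelian subalgebra) whose adjoint
  action is simultaneously diagonalizable.\<close>

definition cartan_subalgebra ::
    "(complex \<Rightarrow> 'g::ab_group_add \<Rightarrow> 'g) \<Rightarrow> ('g \<Rightarrow> 'g \<Rightarrow> 'g) \<Rightarrow> 'g set \<Rightarrow> bool" where
  "cartan_subalgebra scale bracket H \<longleftrightarrow>
     H = root_space scale bracket H 0 \<and>
     module.span scale (\<Union>\<phi>\<in>dual_of scale H. root_space scale bracket H \<phi>) = UNIV"

definition roots ::
    "(complex \<Rightarrow> 'g::ab_group_add \<Rightarrow> 'g) \<Rightarrow> ('g \<Rightarrow> 'g \<Rightarrow> 'g) \<Rightarrow> 'g set \<Rightarrow> ('g \<Rightarrow> complex) set" where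
  "roots scale bracket H =
     {\<phi> \<in> dual_of scale H. \<phi> \<noteq> 0 \<and> root_space scale bracket H \<phi> \<noteq> {0}}"

text \<open>An element \<open>\<Sum>\<^sub>i \<beta>\<^sub>i \<alpha>\<^sub>i\<close> of \<open>Q\<^sub>+\<close> is given by its coordinates \<open>\<beta> :: 'r \<Rightarrow> nat\<close>;
  \<open>qelt \<alpha> \<beta>\<close> is the corresponding functional, and the coordinates of \<open>\<alpha>\<^sub>i\<close> are \<open>unit_vec i\<close>.\<close>

definition qelt :: "('r::finite \<Rightarrow> 'g \<Rightarrow> complex) \<Rightarrow> ('r \<Rightarrow> nat) \<Rightarrow> 'g \<Rightarrow> complex" where
  "qelt \<alpha> \<beta> = (\<lambda>t. \<Sum>i\<in>UNIV. of_nat (\<beta> i) * \<alpha> i t)"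

definition unit_vec :: "'r \<Rightarrow> 'r \<Rightarrow> nat" where
  "unit_vec i = (\<lambda>j. if j = i then 1 else 0)"

definition simple_roots ::
    "(complex \<Rightarrow> 'g::ab_group_add \<Rightarrow> 'g) \<Rightarrow> ('g \<Rightarrow> 'g \<Rightarrow> 'g) \<Rightarrow> 'g set \<Rightarrow>
     ('r::finite \<Rightarrow> 'g \<Rightarrow> complex) \<Rightarrow> bool" where
  "simple_roots scale bracket H \<alpha> \<longleftrightarrow>
     (\<forall>i. \<alpha> i \<in> roots scale bracket H) \<and>
     (\<forall>c :: 'r \<Rightarrow> complex. (\<Sum>i\<in>UNIV. fscale (c i) (\<alpha> i)) = 0 \<longrightarrow> c = 0) \<and>
     (\<forall>\<phi>\<in>roots scale bracket H. \<exists>\<beta>. \<phi> = qelt \<alpha> \<beta> \<or> \<phi> = - qelt \<alpha> \<beta>)"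

definition n_plus ::
    "(complex \<Rightarrow> 'g::ab_group_add \<Rightarrow> 'g) \<Rightarrow> ('g \<Rightarrow> 'g \<Rightarrow> 'g) \<Rightarrow> 'g set \<Rightarrow>
     ('r::finite \<Rightarrow> 'g \<Rightarrow> complex) \<Rightarrow> 'g set" where
  "n_plus scale bracket H \<alpha> =
     module.span scale (\<Union>\<phi> \<in> roots scale bracket H \<inter> range (qelt \<alpha>). root_space scale bracket H \<phi>)"

definition n_minus ::
    "(complex \<Rightarrow> 'g::ab_group_add \<Rightarrow> 'g) \<Rightarrow> ('g \<Rightarrow> 'g \<Rightarrow> 'g) \<Rightarrow> 'g set \<Rightarrow>
     ('r::finite \<Rightarrow> 'g \<Rightarrow> complex) \<Rightarrow> 'g set" where
  "n_minus scale bracket H \<alpha> =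
     module.span scale (\<Union>\<phi> \<in> roots scale bracket H \<inter> range (\<lambda>\<beta>. - qelt \<alpha> \<beta>). root_space scale bracket H \<phi>)"

section \<open>Chevalley generators and the form on the dual of the Cartan subalgebra\<close>

text \<open>For the matrix \<open>C i j = \<alpha>\<^sub>i(h\<^sub>j)\<close> below, finite type is automatic, as the Lie algebra is
  finite-dimensional and simple.\<close>

definition generalized_cartan_matrix :: "('r \<Rightarrow> 'r \<Rightarrow> int) \<Rightarrow> bool" where
  "generalized_cartan_matrix C \<longleftrightarrow>
     (\<forall>i. C i i = 2) \<and>
     (\<forall>i j. i \<noteq> j \<longrightarrow> C i j \<le> 0) \<and>
     (\<forall>i j. C i j = 0 \<longleftrightarrow> C j i = 0)"

definition coroot :: "('r \<Rightarrow> 'g \<Rightarrow> complex) \<Rightarrow> ('r \<Rightarrow> nat) \<Rightarrow> 'r \<Rightarrow> 'g \<Rightarrow> complex" where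
  "coroot \<alpha> d i = fscale (1 / of_nat (d i)) (\<alpha> i)"

text \<open>The rank is the cardinality of the index type \<open>'r\<close>. The index convention is
  \<open>[h\<^sub>i, e\<^sub>j] = C\<^sub>j\<^sub>i e\<^sub>j\<close>, i.e. \<open>C\<^sub>j\<^sub>i = \<alpha>\<^sub>j(h\<^sub>i)\<close>. The \<open>\<omega>\<^sub>i\<close> are the fundamental weights.\<close>

locale chevalley_data = lie_algebra scale bracket
  for scale :: "complex \<Rightarrow> 'g::ab_group_add \<Rightarrow> 'g"
    and bracket :: "'g \<Rightarrow> 'g \<Rightarrow> 'g" +
  fixes H :: "'g set"
    and \<alpha> :: "'r::finite \<Rightarrow> 'g \<Rightarrow> complex"
    and C :: "'r \<Rightarrow> 'r \<Rightarrow> int"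
    and d :: "'r \<Rightarrow> nat"
    and e f h :: "'r \<Rightarrow> 'g"
    and form :: "('g \<Rightarrow> complex) \<Rightarrow> ('g \<Rightarrow> complex) \<Rightarrow> complex"
    and \<omega> :: "'r \<Rightarrow> 'g \<Rightarrow> complex"
  assumes finite_dimensional: "finite_dim scale"
    and simple: "lie_simple scale bracket"
    and cartan: "cartan_subalgebra scale bracket H"
    and simple_roots: "simple_roots scale bracket H \<alpha>"
    \<comment> \<open>Chevalley generators\<close>
    and h_basis: "inj h" "\<not> module.dependent scale (range h)" "module.span scale (range h) = H"
    and e_root: "e i \<in> root_space scale bracket H (\<alpha> i)"
    and f_root: "f i \<in> root_space scale bracket H (- \<alpha> i)"
    and e_generate: "lie_subalgebra scale bracket hull range e = n_plus scale bracket H \<alpha>"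
    and f_generate: "lie_subalgebra scale bracket hull range f = n_minus scale bracket H \<alpha>"
    and cartan_matrix: "generalized_cartan_matrix C"
    and root_h: "\<alpha> j (h i) = of_int (C j i)"
    and bracket_hh: "bracket (h i) (h j) = 0"
    and bracket_he: "bracket (h i) (e j) = scale (of_int (C j i)) (e j)"
    and bracket_hf: "bracket (h i) (f j) = - scale (of_int (C j i)) (f j)"
    and bracket_ef: "bracket (e i) (f j) = (if i = j then h j else 0)"
    and serre_e: "i \<noteq> j \<Longrightarrow> (bracket (e j) ^^ nat (1 - C i j)) (e i) = 0"
    and serre_f: "i \<noteq> j \<Longrightarrow> (bracket (f j) ^^ nat (1 - C i j)) (f i) = 0"
    and d_pos: "0 < d i"
    and d_coprime: "Gcd (range d) = 1"
    and d_symmetrizes: "C i j * int (d j) = C j i * int (d i)"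
    \<comment> \<open>the form on the dual of \<open>H\<close>\<close>
    and form_add: "\<lbrakk>\<phi> \<in> dual_of scale H; \<psi> \<in> dual_of scale H; \<chi> \<in> dual_of scale H\<rbrakk>
          \<Longrightarrow> form (\<phi> + \<psi>) \<chi> = form \<phi> \<chi> + form \<psi> \<chi>"
    and form_scale: "\<lbrakk>\<phi> \<in> dual_of scale H; \<chi> \<in> dual_of scale H\<rbrakk>
          \<Longrightarrow> form (fscale c \<phi>) \<chi> = c * form \<phi> \<chi>"
    and form_sym: "\<lbrakk>\<phi> \<in> dual_of scale H; \<chi> \<in> dual_of scale H\<rbrakk> \<Longrightarrow> form \<phi> \<chi> = form \<chi> \<phi>"
    and form_roots: "form (\<alpha> i) (coroot \<alpha> d j) = of_int (C i j)"
    and form_coroot: "\<phi> \<in> dual_of scale H \<Longrightarrow> \<phi> (h j) = form \<phi> (coroot \<alpha> d j)"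
    and omega_dual: "\<omega> i \<in> dual_of scale H"
    and omega_coroot: "form (\<omega> i) (coroot \<alpha> d j) = (if i = j then 1 else 0)"

section \<open>Verma modules\<close>

locale lie_module = lie_algebra scale bracket + V: vector_space scaleV
  for scale :: "complex \<Rightarrow> 'g::ab_group_add \<Rightarrow> 'g"
    and bracket :: "'g \<Rightarrow> 'g \<Rightarrow> 'g"
    and scaleV :: "complex \<Rightarrow> 'v::ab_group_add \<Rightarrow> 'v" +
  fixes act :: "'g \<Rightarrow> 'v \<Rightarrow> 'v"
  assumes act_add_left: "act (x + y) v = act x v + act y v"
    and act_add_right: "act x (v + w) = act x v + act x w"
    and act_scale_left: "act (scale c x) v = scaleV c (act x v)"
    and act_scale_right: "act x (scaleV c v) = scaleV c (act x v)"
    and act_bracket: "act (bracket x y) v = act x (act y v) - act y (act x v)"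

definition irreducible_module ::
    "(complex \<Rightarrow> 'v::ab_group_add \<Rightarrow> 'v) \<Rightarrow> ('g \<Rightarrow> 'v \<Rightarrow> 'v) \<Rightarrow> bool" where
  "irreducible_module scaleV act \<longleftrightarrow>
     (\<exists>v::'v. v \<noteq> 0) \<and>
     (\<forall>W. module.subspace scaleV W \<and> (\<forall>x. \<forall>v\<in>W. act x v \<in> W) \<longrightarrow> W = {0} \<or> W = UNIV)"

definition weight_space ::
    "(complex \<Rightarrow> 'v::ab_group_add \<Rightarrow> 'v) \<Rightarrow> ('g \<Rightarrow> 'v \<Rightarrow> 'v) \<Rightarrow> 'g set \<Rightarrow> ('g \<Rightarrow> complex) \<Rightarrow> 'v set" where
  "weight_space scaleV act H \<nu> = {v. \<forall>t\<in>H. act t v = scaleV (\<nu> t) v}"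

text \<open>The type \<open>'g list \<Rightarrow>\<^sub>0 complex\<close> carries the free vector space on the words in elements of \<open>\<gg>\<close>.
  Modulo the span of \<open>enveloping_relations\<close> (multilinearity and \<open>xy - yx = [x,y]\<close>, inside arbitrary
  words) it is the universal enveloping algebra \<open>U(\<gg>)\<close>, with concatenation as product. Modulo the
  span of \<open>verma_relations\<close> it is the quotient of \<open>U(\<gg>)\<close> by the left ideal generated by \<open>\<nn>\<^sub>+\<close> and
  all \<open>t - \<Lambda>(t)\<close>, \<open>t\<close> in the Cartan subalgebra.\<close>

abbreviation word :: "'g list \<Rightarrow> 'g list \<Rightarrow>\<^sub>0 complex" where
  "word u \<equiv> Poly_Mapping.single u 1"

definition word_scale :: "complex \<Rightarrow> ('g list \<Rightarrow>\<^sub>0 complex) \<Rightarrow> 'g list \<Rightarrow>\<^sub>0 complex" where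
  "word_scale c p = Poly_Mapping.map ((*) c) p"

definition enveloping_relations ::
    "(complex \<Rightarrow> 'g::ab_group_add \<Rightarrow> 'g) \<Rightarrow> ('g \<Rightarrow> 'g \<Rightarrow> 'g) \<Rightarrow> ('g list \<Rightarrow>\<^sub>0 complex) set" where
  "enveloping_relations scale bracket =
     {word (u @ [x + y] @ w) - word (u @ [x] @ w) - word (u @ [y] @ w) | u w x y. True} \<union>
     {word (u @ [scale c x] @ w) - word_scale c (word (u @ [x] @ w)) | u w c x. True} \<union>
     {word (u @ [x, y] @ w) - word (u @ [y, x] @ w) - word (u @ [bracket x y] @ w) | u w x y. True}"

definition verma_relations ::
    "(complex \<Rightarrow> 'g::ab_group_add \<Rightarrow> 'g) \<Rightarrow> ('g \<Rightarrow> 'g \<Rightarrow> 'g) \<Rightarrow> 'g set \<Rightarrow>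
     ('r::finite \<Rightarrow> 'g \<Rightarrow> complex) \<Rightarrow> ('g \<Rightarrow> complex) \<Rightarrow> ('g list \<Rightarrow>\<^sub>0 complex) set" where
  "verma_relations scale bracket H \<alpha> \<Lambda> =
     enveloping_relations scale bracket \<union>
     {word (u @ [x]) | u x. x \<in> n_plus scale bracket H \<alpha>} \<union>
     {word (u @ [t]) - word_scale (\<Lambda> t) (word u) | u t. t \<in> H}"

definition apply_words ::
    "(complex \<Rightarrow> 'v::ab_group_add \<Rightarrow> 'v) \<Rightarrow> ('g \<Rightarrow> 'v \<Rightarrow> 'v) \<Rightarrow> 'v \<Rightarrow> ('g list \<Rightarrow>\<^sub>0 complex) \<Rightarrow> 'v" where
  "apply_words scaleV act v p =
     (\<Sum>u\<in>Poly_Mapping.keys p. scaleV (Poly_Mapping.lookup p u) (foldr act u v))"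

text \<open>\<open>V\<close> is the Verma module of highest weight \<open>\<Lambda>\<close> with highest weight vector \<open>v0\<close>: the map
  \<open>u \<mapsto> u v0\<close> induces an isomorphism of \<open>U(\<gg>) / U(\<gg>)(\<nn>\<^sub>+ + {t - \<Lambda>(t)})\<close> with \<open>V\<close>.\<close>

definition verma_module ::
    "(complex \<Rightarrow> 'g::ab_group_add \<Rightarrow> 'g) \<Rightarrow> ('g \<Rightarrow> 'g \<Rightarrow> 'g) \<Rightarrow> 'g set \<Rightarrow>
     ('r::finite \<Rightarrow> 'g \<Rightarrow> complex) \<Rightarrow> ('g \<Rightarrow> complex) \<Rightarrow>
     (complex \<Rightarrow> 'v::ab_group_add \<Rightarrow> 'v) \<Rightarrow> ('g \<Rightarrow> 'v \<Rightarrow> 'v) \<Rightarrow> 'v \<Rightarrow> bool" where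
  "verma_module scale bracket H \<alpha> \<Lambda> scaleV act v0 \<longleftrightarrow>
     lie_module scale bracket scaleV act \<and>
     range (apply_words scaleV act v0) = UNIV \<and>
     {p. apply_words scaleV act v0 p = 0} =
       module.span word_scale (verma_relations scale bracket H \<alpha> \<Lambda>)"

text \<open>A vector of the completion \<open>\<Prod>\<^sub>\<beta> V[\<Lambda> - \<beta>]\<close> is the family of its components.\<close>

definition completion ::
    "(complex \<Rightarrow> 'v::ab_group_add \<Rightarrow> 'v) \<Rightarrow> ('g \<Rightarrow> 'v \<Rightarrow> 'v) \<Rightarrow> 'g set \<Rightarrow>
     ('r::finite \<Rightarrow> 'g \<Rightarrow> complex) \<Rightarrow> ('g \<Rightarrow> complex) \<Rightarrow> (('r \<Rightarrow> nat) \<Rightarrow> 'v) set" where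
  "completion scaleV act H \<alpha> \<Lambda> = {w. \<forall>\<beta>. w \<beta> \<in> weight_space scaleV act H (\<Lambda> - qelt \<alpha> \<beta>)}"

text \<open>As \<open>e\<^sub>i\<close> maps \<open>V[\<Lambda> - \<beta> - \<alpha>\<^sub>i]\<close> to \<open>V[\<Lambda> - \<beta>]\<close> (and kills \<open>V[\<Lambda> - \<beta>]\<close> if \<open>\<beta>\<^sub>i = 0\<close>), its
  action on the completion is the following.\<close>

definition raise ::
    "('g \<Rightarrow> 'v \<Rightarrow> 'v) \<Rightarrow> ('r \<Rightarrow> 'g) \<Rightarrow> 'r \<Rightarrow> (('r \<Rightarrow> nat) \<Rightarrow> 'v) \<Rightarrow> ('r \<Rightarrow> nat) \<Rightarrow> 'v" where
  "raise act e i w = (\<lambda>\<beta>. act (e i) (w (\<beta> + unit_vec i)))"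

text \<open>The functional \<open>\<langle>\<Lambda>|\<close> on \<open>V\<close>. It kills \<open>V[\<Lambda> - \<beta>]\<close> for \<open>\<beta> \<noteq> 0\<close>, so it extends to the
  completion as its value on the component at \<open>\<beta> = 0\<close>.\<close>

definition bra ::
    "(complex \<Rightarrow> 'v::ab_group_add \<Rightarrow> 'v) \<Rightarrow> ('g \<Rightarrow> 'v \<Rightarrow> 'v) \<Rightarrow> 'g set \<Rightarrow>
     ('r::finite \<Rightarrow> 'g \<Rightarrow> complex) \<Rightarrow> ('g \<Rightarrow> complex) \<Rightarrow> 'v \<Rightarrow> 'v \<Rightarrow> complex" where
  "bra scaleV act H \<alpha> \<Lambda> v0 =
     (THE \<phi>. Vector_Spaces.linear scaleV (*) \<phi> \<and> \<phi> v0 = 1 \<and>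
        (\<forall>\<beta>. \<beta> \<noteq> 0 \<longrightarrow> (\<forall>v \<in> weight_space scaleV act H (\<Lambda> - qelt \<alpha> \<beta>). \<phi> v = 0)))"

definition bra_completion ::
    "(complex \<Rightarrow> 'v::ab_group_add \<Rightarrow> 'v) \<Rightarrow> ('g \<Rightarrow> 'v \<Rightarrow> 'v) \<Rightarrow> 'g set \<Rightarrow>
     ('r::finite \<Rightarrow> 'g \<Rightarrow> complex) \<Rightarrow> ('g \<Rightarrow> complex) \<Rightarrow> 'v \<Rightarrow> (('r \<Rightarrow> nat) \<Rightarrow> 'v) \<Rightarrow> complex" where
  "bra_completion scaleV act H \<alpha> \<Lambda> v0 w = bra scaleV act H \<alpha> \<Lambda> v0 (w 0)"

definition whittaker_vector ::
    "(complex \<Rightarrow> 'v::ab_group_add \<Rightarrow> 'v) \<Rightarrow> ('g \<Rightarrow> 'v \<Rightarrow> 'v) \<Rightarrow> 'g set \<Rightarrow>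
     ('r::finite \<Rightarrow> 'g \<Rightarrow> complex) \<Rightarrow> ('r \<Rightarrow> 'g) \<Rightarrow> ('g \<Rightarrow> complex) \<Rightarrow> 'v \<Rightarrow>
     ('r \<Rightarrow> complex) \<Rightarrow> (('r \<Rightarrow> nat) \<Rightarrow> 'v) \<Rightarrow> bool" where
  "whittaker_vector scaleV act H \<alpha> e \<Lambda> v0 \<mu> w \<longleftrightarrow>
     w \<in> completion scaleV act H \<alpha> \<Lambda> \<and>
     bra_completion scaleV act H \<alpha> \<Lambda> v0 w = 1 \<and>
     (\<forall>i. raise act e i w = (\<lambda>\<beta>. scaleV (\<mu> i) (w \<beta>)))"

section \<open>Vertex weights and paths\<close>

definition rho :: "('r::finite \<Rightarrow> 'g \<Rightarrow> complex) \<Rightarrow> 'g \<Rightarrow> complex" where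
  "rho \<omega> = (\<Sum>i\<in>UNIV. \<omega> i)"

definition vertex_weight ::
    "(('g \<Rightarrow> complex) \<Rightarrow> ('g \<Rightarrow> complex) \<Rightarrow> complex) \<Rightarrow> ('r::finite \<Rightarrow> 'g \<Rightarrow> complex) \<Rightarrow>
     ('r \<Rightarrow> 'g \<Rightarrow> complex) \<Rightarrow> ('g \<Rightarrow> complex) \<Rightarrow> ('r \<Rightarrow> nat) \<Rightarrow> complex" where
  "vertex_weight form \<alpha> \<omega> \<Lambda> \<beta> =
     form (\<Lambda> + rho \<omega>) (qelt \<alpha> \<beta>) - 1 / 2 * form (qelt \<alpha> \<beta>) (qelt \<alpha> \<beta>)"

definition generic_weight ::
    "(('g \<Rightarrow> complex) \<Rightarrow> ('g \<Rightarrow> complex) \<Rightarrow> complex) \<Rightarrow> ('r::finite \<Rightarrow> 'g \<Rightarrow> complex) \<Rightarrow>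
     ('r \<Rightarrow> 'g \<Rightarrow> complex) \<Rightarrow> ('g \<Rightarrow> complex) \<Rightarrow>
     (complex \<Rightarrow> 'v::ab_group_add \<Rightarrow> 'v) \<Rightarrow> ('g \<Rightarrow> 'v \<Rightarrow> 'v) \<Rightarrow> bool" where
  "generic_weight form \<alpha> \<omega> \<Lambda> scaleV act \<longleftrightarrow>
     irreducible_module scaleV act \<and>
     (\<forall>\<beta>. \<beta> \<noteq> 0 \<longrightarrow> vertex_weight form \<alpha> \<omega> \<Lambda> \<beta> \<noteq> 0)"

text \<open>A path \<open>(p\<^sub>0, \<dots>, p\<^sub>N)\<close> is the list of its \<open>N + 1\<close> vertices.\<close>

definition paths :: "('r \<Rightarrow> nat) \<Rightarrow> ('r \<Rightarrow> nat) list set" where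
  "paths \<beta> = {p. p \<noteq> [] \<and> hd p = 0 \<and> last p = \<beta> \<and>
     (\<forall>k. Suc k < length p \<longrightarrow> (\<exists>i. p ! Suc k = p ! k + unit_vec i))}"

fun step_indices :: "('r \<Rightarrow> nat) list \<Rightarrow> 'r list" where
  "step_indices (p # q # ps) = (THE i. q = p + unit_vec i) # step_indices (q # ps)"
| "step_indices ps = []"

text \<open>\<open>fold\<close> applies \<open>f\<^sub>i\<^sub>1\<close> first, so this is \<open>f\<^sub>i\<^sub>N \<cdots> f\<^sub>i\<^sub>1 v0\<close>.\<close>

definition path_vector ::
    "('g \<Rightarrow> 'v \<Rightarrow> 'v) \<Rightarrow> ('r \<Rightarrow> 'g) \<Rightarrow> 'v \<Rightarrow> ('r \<Rightarrow> nat) list \<Rightarrow> 'v" where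
  "path_vector act f v0 p = fold (\<lambda>i. act (f i)) (step_indices p) v0"

definition path_weight :: "(('r \<Rightarrow> nat) \<Rightarrow> complex) \<Rightarrow> ('r \<Rightarrow> nat) list \<Rightarrow> complex" where
  "path_weight v p = (\<Prod>q\<leftarrow>tl p. 1 / v q)"

definition Z_vector ::
    "(complex \<Rightarrow> 'v::ab_group_add \<Rightarrow> 'v) \<Rightarrow> ('g \<Rightarrow> 'v \<Rightarrow> 'v) \<Rightarrow> ('r \<Rightarrow> 'g) \<Rightarrow> 'v \<Rightarrow>
     (('r \<Rightarrow> nat) \<Rightarrow> complex) \<Rightarrow> ('r \<Rightarrow> nat) \<Rightarrow> 'v" where
  "Z_vector scaleV act f v0 v \<beta> =
     (\<Sum>p\<in>paths \<beta>. scaleV (path_weight v p) (path_vector act f v0 p))"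

end

theory Submission
  imports Defs
begin

text \<open>The vectors \<open>Z\<^sub>\<beta>\<close> satisfy the recursion \<open>v(\<beta>) Z\<^sub>\<beta> = \<Sum>\<^sub>i f\<^sub>i Z\<^bsub>\<beta> - \<alpha>\<^sub>i\<^esub>\<close>. The vertex
  weights are chosen so that \<open>v(\<beta> + \<alpha>\<^sub>j) - v(\<beta>) = d\<^sub>j (\<Lambda> - \<beta>)(h\<^sub>j)\<close>; commuting \<open>e\<^sub>j\<close> through the
  recursion therefore gives \<open>e\<^sub>j Z\<^bsub>\<beta> + \<alpha>\<^sub>j\<^esub> = Z\<^sub>\<beta> / d\<^sub>j\<close> by induction on the height of \<open>\<beta>\<close>, without
  any use of the Casimir element. For uniqueness, the lowest component at which two Whittaker vectors
  differ gives a singular vector of weight below \<open>\<Lambda>\<close>, and such a vector generates a proper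
  submodule.\<close>

section \<open>Weight spaces\<close>

lemma sum_apply: "(\<Sum>i\<in>A. g i) x = (\<Sum>i\<in>A. g i x)"
  by (induction A rule: infinite_finite_induct) auto

lemma dual_of_add: "\<phi> \<in> dual_of scale H \<Longrightarrow> \<psi> \<in> dual_of scale H \<Longrightarrow> \<phi> + \<psi> \<in> dual_of scale H"
  by (auto simp: dual_of_def algebra_simps)

lemma dual_of_diff: "\<phi> \<in> dual_of scale H \<Longrightarrow> \<psi> \<in> dual_of scale H \<Longrightarrow> \<phi> - \<psi> \<in> dual_of scale H"
  by (auto simp: dual_of_def algebra_simps)

lemma dual_of_sum:
  "(\<And>i. i \<in> A \<Longrightarrow> \<phi> i \<in> dual_of scale H) \<Longrightarrow> (\<Sum>i\<in>A. \<phi> i) \<in> dual_of scale H"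
proof (induction A rule: infinite_finite_induct)
  case (insert x F)
  have "\<phi> x + (\<Sum>i\<in>F. \<phi> i) \<in> dual_of scale H"
    by (intro dual_of_add insert) (auto intro: insert)
  then show ?case using insert.hyps by (metis sum.insert)
qed (auto simp: dual_of_def)

lemma dual_of_fscale: "\<phi> \<in> dual_of scale H \<Longrightarrow> fscale c \<phi> \<in> dual_of scale H"
  by (auto simp: dual_of_def fscale_def algebra_simps)

context lie_module
begin

lemma act_zero_left [simp]: "act 0 v = 0"
  using act_add_left[of 0 0 v] by simp

lemma act_zero_right [simp]: "act x 0 = 0"
  using act_add_right[of x 0 0] by simp

lemma act_minus_right: "act x (- v) = - act x v"
  using act_add_right[of x v "- v"] by (simp add: eq_neg_iff_add_eq_0 add.commute)

lemma act_diff_right: "act x (v - w) = act x v - act x w"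
  using act_add_right[of x v "- w"] by (simp add: act_minus_right)

lemma act_sum_right: "act x (\<Sum>i\<in>A. g i) = (\<Sum>i\<in>A. act x (g i))"
  by (induction A rule: infinite_finite_induct) (auto simp: act_add_right)

lemma act_swap: "act x (act y v) = act y (act x v) + act (bracket x y) v"
  by (simp add: act_bracket)

lemma weight_spaceD: "v \<in> weight_space scaleV act H \<nu> \<Longrightarrow> t \<in> H \<Longrightarrow> act t v = scaleV (\<nu> t) v"
  by (simp add: weight_space_def)

lemma subspace_weight_space: "V.subspace (weight_space scaleV act H \<nu>)"
  by (rule V.subspaceI)
    (auto simp: weight_space_def act_add_right V.scale_right_distrib act_scale_right mult.commute)

text \<open>Moving \<open>t\<close> past \<open>x\<close> costs \<open>bracket t x\<close>, which is
  \<open>\<phi> t\<close> times \<open>x\<close>, so the two eigenvalues add.\<close>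

lemma act_root_space:
  assumes x: "x \<in> root_space scale bracket H \<phi>" and v: "v \<in> weight_space scaleV act H \<nu>"
  shows "act x v \<in> weight_space scaleV act H (\<nu> + \<phi>)"
proof -
  have "act t (act x v) = scaleV ((\<nu> + \<phi>) t) (act x v)" if t: "t \<in> H" for t
  proof -
    have "act t (act x v) = act x (act t v) + act (bracket t x) v"
      by (rule act_swap)
    also have "\<dots> = scaleV ((\<nu> + \<phi>) t) (act x v)"
      using x v t
      by (simp add: weight_space_def root_space_def act_scale_left act_scale_right V.scale_left_distrib)
    finally show ?thesis .
  qed
  then show ?thesis by (simp add: weight_space_def)
qed

text \<open>The operator t - \<nu>0(t) removes one summand and only rescales the others, so the
  induction hypothesis applies to a shorter vanishing sum.\<close>

lemma weight_vectors_independent: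
  assumes "finite F" "F \<subseteq> dual_of scale H"
    and "\<And>\<nu>. \<nu> \<in> F \<Longrightarrow> u \<nu> \<in> weight_space scaleV act H \<nu>"
    and "(\<Sum>\<nu>\<in>F. u \<nu>) = 0"
  shows "\<forall>\<nu>\<in>F. u \<nu> = 0"
  using assms
proof (induction F arbitrary: u rule: finite_induct)
  case empty
  then show ?case by simp
next
  case (insert \<nu>0 F)
  have *: "u \<nu>1 = 0" if \<nu>1: "\<nu>1 \<in> F" for \<nu>1
  proof -
    from \<nu>1 insert.hyps have "\<nu>1 \<noteq> \<nu>0" by blast
    then obtain t where t: "\<nu>1 t \<noteq> \<nu>0 t" by blast
    \<comment> \<open>Elements of \<open>dual_of scale H\<close> vanish outside \<open>H\<close>, so
      two of them can differ only at a point of \<open>H\<close>.\<close>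
    have tH: "t \<in> H"
    proof (rule ccontr)
      assume "t \<notin> H"
      then have "\<nu>1 t = 0" "\<nu>0 t = 0"
        using insert.prems(1) \<nu>1 by (auto simp: dual_of_def)
      then show False using t by simp
    qed
    \<comment> \<open>The effect of \<open>t\<close> minus the scalar \<open>\<nu>0 t\<close>: the
      summand at \<open>\<nu>0\<close> dies, the one at \<open>\<nu>1\<close> gets a nonzero
      factor.\<close>
    define u' where "u' \<nu> = scaleV (\<nu> t - \<nu>0 t) (u \<nu>)" for \<nu>
    have "act t (\<Sum>\<nu>\<in>insert \<nu>0 F. u \<nu>) - scaleV (\<nu>0 t) (\<Sum>\<nu>\<in>insert \<nu>0 F. u \<nu>)
        = (\<Sum>\<nu>\<in>insert \<nu>0 F. act t (u \<nu>) - scaleV (\<nu>0 t) (u \<nu>))"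
      by (simp only: act_sum_right V.scale_sum_right sum_subtractf)
    also have "\<dots> = (\<Sum>\<nu>\<in>insert \<nu>0 F. u' \<nu>)"
      by (intro sum.cong refl)
        (simp add: u'_def weight_spaceD[OF insert.prems(2) tH] V.scale_left_diff_distrib)
    also have "\<dots> = (\<Sum>\<nu>\<in>F. u' \<nu>)"
      using insert.hyps by (simp add: u'_def)
    finally have "(\<Sum>\<nu>\<in>F. u' \<nu>) = 0"
      by (simp only: insert.prems(3)) simp
    moreover have "u' \<nu> \<in> weight_space scaleV act H \<nu>" if "\<nu> \<in> F" for \<nu>
      unfolding u'_def using insert.prems(2) that
      by (intro V.subspace_scale[OF subspace_weight_space]) auto
    ultimately have "u' \<nu>1 = 0"
      using insert.IH[of u'] insert.prems(1) \<nu>1 by blast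
    then show ?thesis using t by (simp add: u'_def)
  qed
  then have "u \<nu>0 = 0"
    using insert.prems(3) insert.hyps by simp
  with * show ?case by simp
qed

lemma span_weight_spacesE:
  assumes "v \<in> V.span (\<Union>\<kappa>\<in>S. weight_space scaleV act H \<kappa>)"
  obtains F u where "finite F" "F \<subseteq> S" "\<And>\<kappa>. u \<kappa> \<in> weight_space scaleV act H \<kappa>"
    "\<And>\<kappa>. \<kappa> \<notin> F \<Longrightarrow> u \<kappa> = 0" "v = (\<Sum>\<kappa>\<in>F. u \<kappa>)"
proof -
  define P where "P v \<longleftrightarrow> (\<exists>F u. finite F \<and> F \<subseteq> S \<and> (\<forall>\<kappa>. u \<kappa> \<in> weight_space scaleV act H \<kappa>) \<and>
    (\<forall>\<kappa>. \<kappa> \<notin> F \<longrightarrow> u \<kappa> = 0) \<and> v = (\<Sum>\<kappa>\<in>F. u \<kappa>))" for v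
  note sub = subspace_weight_space[of H]
  have "P v" using assms
  proof (rule V.span_induct_alt)
    show "P 0"
      unfolding P_def by (rule exI[of _ "{}"], rule exI[of _ "\<lambda>_. 0"])
        (simp add: V.subspace_0[OF sub])
  next
    fix c x y
    assume x: "x \<in> (\<Union>\<kappa>\<in>S. weight_space scaleV act H \<kappa>)" and "P y"
    from x obtain \<kappa>0 where k: "\<kappa>0 \<in> S" "x \<in> weight_space scaleV act H \<kappa>0" by blast
    from \<open>P y\<close> obtain F u where F: "finite F" "F \<subseteq> S" "\<And>\<kappa>. u \<kappa> \<in> weight_space scaleV act H \<kappa>"
      "\<And>\<kappa>. \<kappa> \<notin> F \<Longrightarrow> u \<kappa> = 0" "y = (\<Sum>\<kappa>\<in>F. u \<kappa>)"
      unfolding P_def by blast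
    \<comment> \<open>As \<open>u\<close> vanishes off \<open>F\<close>, adding the new vector at
      \<open>\<kappa>0\<close> is correct whether or not \<open>\<kappa>0\<close> already lies in
      \<open>F\<close>.\<close>
    define u' where "u' \<kappa> = u \<kappa> + (if \<kappa> = \<kappa>0 then scaleV c x else 0)" for \<kappa>
    have "(\<Sum>\<kappa>\<in>insert \<kappa>0 F. u' \<kappa>) = (\<Sum>\<kappa>\<in>insert \<kappa>0 F. u \<kappa>) + scaleV c x"
      using F(1) by (simp only: u'_def sum.distrib) simp
    also have "(\<Sum>\<kappa>\<in>insert \<kappa>0 F. u \<kappa>) = y"
      unfolding F(5) using F(1,4) by (intro sum.mono_neutral_right) auto
    finally have "scaleV c x + y = (\<Sum>\<kappa>\<in>insert \<kappa>0 F. u' \<kappa>)" by simp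
    moreover have "u' \<kappa> \<in> weight_space scaleV act H \<kappa>" for \<kappa>
      using F(3) k(2)
      by (auto simp: u'_def intro!: V.subspace_add[OF sub] V.subspace_scale[OF sub] V.subspace_0[OF sub])
    ultimately show "P (scaleV c x + y)"
      unfolding P_def using F k(1)
      by (intro exI[of _ "insert \<kappa>0 F"] exI[of _ u']) (auto simp: u'_def)
  qed
  then show ?thesis using that unfolding P_def by blast
qed

lemma weight_space_disjoint_span:
  assumes "S \<subseteq> dual_of scale H" "\<nu> \<in> dual_of scale H" "\<nu> \<notin> S"
    and v: "v \<in> weight_space scaleV act H \<nu>"
    and "v \<in> V.span (\<Union>\<kappa>\<in>S. weight_space scaleV act H \<kappa>)"
  shows "v = 0"
proof -
  obtain F u where F: "finite F" "F \<subseteq> S" "\<And>\<kappa>. u \<kappa> \<in> weight_space scaleV act H \<kappa>"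
    "v = (\<Sum>\<kappa>\<in>F. u \<kappa>)"
    using span_weight_spacesE[OF assms(5)] by blast
  \<comment> \<open>Putting \<open>- v\<close> at the new weight \<open>\<nu>\<close> turns the
    expansion of \<open>v\<close> into a vanishing sum of weight vectors.\<close>
  define u' where "u' = u(\<nu> := - v)"
  have notin: "\<nu> \<notin> F" using F(2) assms(3) by blast
  have "(\<Sum>\<kappa>\<in>F. u' \<kappa>) = v"
    unfolding F(4) using notin by (intro sum.cong) (auto simp: u'_def)
  then have "(\<Sum>\<kappa>\<in>insert \<nu> F. u' \<kappa>) = 0"
    using F(1) notin by (simp add: u'_def)
  moreover have "u' \<kappa> \<in> weight_space scaleV act H \<kappa>" for \<kappa>
    using F(3) v by (auto simp: u'_def V.subspace_neg[OF subspace_weight_space])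
  ultimately have "\<forall>\<kappa>\<in>insert \<nu> F. u' \<kappa> = 0"
    using F(1,2) assms(1,2) by (intro weight_vectors_independent[where H = H]) auto
  then show ?thesis by (simp add: u'_def)
qed

lemma act_in_span:
  assumes "v \<in> V.span B" "\<And>b. b \<in> B \<Longrightarrow> act x b \<in> V.span B"
  shows "act x v \<in> V.span B"
  using assms(1)
  by (induction rule: V.span_induct_alt)
    (auto simp: act_add_right act_scale_right intro: V.span_add V.span_scale assms(2) V.span_zero)

text \<open>A bracket acts as a commutator, so stabilizing a subspace passes to brackets. Stability
  may thus be tested on generators of a subalgebra.\<close>

lemma lie_subalgebra_stabilizer:
  assumes "V.subspace N"
  shows "lie_subalgebra scale bracket {x. \<forall>v\<in>N. act x v \<in> N}"
  unfolding lie_subalgebra_def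
  by (auto intro!: subspaceI simp: act_add_left act_scale_left act_bracket V.subspace_0[OF assms]
      V.subspace_add[OF assms] V.subspace_scale[OF assms] V.subspace_diff[OF assms])

end

section \<open>Coordinates of the positive root lattice and paths\<close>

lemma unit_vec_self [simp]: "unit_vec i i = 1"
  by (simp add: unit_vec_def)

lemma unit_vec_other: "j \<noteq> i \<Longrightarrow> unit_vec i j = 0"
  by (simp add: unit_vec_def)

lemma inj_unit_vec: "unit_vec i = unit_vec j \<Longrightarrow> i = j"
  by (metis unit_vec_self unit_vec_other zero_neq_one)

lemma add_unit_vec_diff [simp]: "\<beta> + unit_vec i - unit_vec i = \<beta>"
  by (auto simp: fun_eq_iff)

text \<open>Subtraction of coordinates is truncated at 0; positivity of \<open>\<beta> i\<close>
  makes it invertible here.\<close>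

lemma diff_unit_vec_add: "0 < \<beta> i \<Longrightarrow> \<beta> - unit_vec i + unit_vec i = \<beta>"
  by (auto simp: fun_eq_iff unit_vec_def)

lemma add_unit_vec_neq_0: "\<beta> + unit_vec i \<noteq> 0"
  by (auto simp: fun_eq_iff intro!: exI[of _ i])

lemma qelt_add: "qelt \<alpha> (\<beta> + \<gamma>) = qelt \<alpha> \<beta> + qelt \<alpha> \<gamma>"
  by (simp add: qelt_def fun_eq_iff sum.distrib distrib_right)

lemma qelt_zero [simp]: "qelt \<alpha> 0 = 0"
  by (simp add: qelt_def fun_eq_iff)

lemma qelt_unit_vec [simp]: "qelt \<alpha> (unit_vec i) = \<alpha> i"
proof
  fix t
  have "qelt \<alpha> (unit_vec i) t = (\<Sum>j\<in>UNIV. if j = i then \<alpha> j t else 0)"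
    unfolding qelt_def by (intro sum.cong) (auto simp: unit_vec_def)
  then show "qelt \<alpha> (unit_vec i) t = \<alpha> i t" by simp
qed

text \<open>Induction on the height, the sum of the coordinates. For \<beta> = 0 the hypothesis is
  void, so the base case is part of the step.\<close>

lemma root_lattice_induct [case_names step]:
  fixes \<beta> :: "'r::finite \<Rightarrow> nat"
  assumes step: "\<And>\<beta>. (\<And>i. 0 < \<beta> i \<Longrightarrow> P (\<beta> - unit_vec i)) \<Longrightarrow> P \<beta>"
  shows "P \<beta>"
proof (induction "\<Sum>j\<in>UNIV. \<beta> j" arbitrary: \<beta> rule: less_induct)
  case less
  show ?case
  proof (rule step)
    fix i
    assume "0 < \<beta> i"
    then have "(\<Sum>j\<in>UNIV. (\<beta> - unit_vec i) j) < (\<Sum>j\<in>UNIV. \<beta> j)"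
      by (intro sum_strict_mono_ex1) (auto intro!: exI[of _ i])
    then show "P (\<beta> - unit_vec i)" by (rule less)
  qed
qed

section \<open>Paths, decomposed by their last step\<close>

lemma paths_zero: "paths (0 :: 'r \<Rightarrow> nat) = {[0]}"
proof
  show "{[0]} \<subseteq> paths (0 :: 'r \<Rightarrow> nat)"
    by (auto simp: paths_def)
  show "paths 0 \<subseteq> {[0 :: 'r \<Rightarrow> nat]}"
  proof
    fix p :: "('r \<Rightarrow> nat) list"
    assume "p \<in> paths 0"
    then have p: "p \<noteq> []" "hd p = 0" "last p = 0"
      and step: "\<And>k. Suc k < length p \<Longrightarrow> \<exists>i. p ! Suc k = p ! k + unit_vec i"
      by (auto simp: paths_def)
    have "length p = 1"
    proof (rule ccontr)
      assume "length p \<noteq> 1"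
      \<comment> \<open>A longer path ends with a step, and the target of a step has a positive
        coordinate, so it is not 0.\<close>
      then obtain k where k: "length p = Suc (Suc k)"
        using p(1) by (cases p; cases "tl p") auto
      then obtain i where "p ! Suc k = p ! k + unit_vec i" using step[of k] by auto
      moreover have "p ! Suc k = 0" using p(1,3) k by (simp add: last_conv_nth)
      ultimately show False using add_unit_vec_neq_0 by metis
    qed
    then show "p \<in> {[0]}" using p by (cases p) auto
  qed
qed

lemma path_append:
  assumes "p \<in> paths \<beta>"
  shows "p @ [\<beta> + unit_vec i] \<in> paths (\<beta> + unit_vec i)"
proof -
  have "\<exists>j. (p @ [\<beta> + unit_vec i]) ! Suc k = (p @ [\<beta> + unit_vec i]) ! k + unit_vec j"
    if k: "Suc k < length (p @ [\<beta> + unit_vec i])" for k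
  proof (cases "Suc k < length p")
    case True
    then show ?thesis using assms by (auto simp: paths_def nth_append)
  next
    \<comment> \<open>The only step not inside \<open>p\<close> leads from its last vertex \<beta>
      to the appended one.\<close>
    case False
    then have "Suc k = length p" using k by simp
    moreover from this have "p ! k = \<beta>"
      using assms by (metis (mono_tags, lifting) diff_Suc_1 last_conv_nth mem_Collect_eq paths_def)
    ultimately show ?thesis by (auto simp: nth_append)
  qed
  then show ?thesis using assms by (auto simp: paths_def)
qed

lemma path_cases:
  assumes "p \<in> paths \<beta>" "\<beta> \<noteq> 0"
  obtains q i where "0 < \<beta> i" "q \<in> paths (\<beta> - unit_vec i)" "p = q @ [\<beta>]"
proof -
  from assms have p: "p \<noteq> []" "hd p = 0" "last p = \<beta>"
    and step: "\<And>k. Suc k < length p \<Longrightarrow> \<exists>i. p ! Suc k = p ! k + unit_vec i"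
    by (auto simp: paths_def)
  define q where "q = butlast p"
  have pq: "p = q @ [\<beta>]" using p by (metis append_butlast_last_id q_def)
  have "q \<noteq> []" using p assms(2) pq by (cases q) auto
  then obtain k where k: "length q = Suc k" by (cases q) auto
  obtain i where i: "p ! Suc k = p ! k + unit_vec i"
    using step[of k] k pq by auto
  have bi: "\<beta> = last q + unit_vec i"
    using i k pq \<open>q \<noteq> []\<close> by (simp add: nth_append last_conv_nth)
  have "\<exists>i. q ! Suc k = q ! k + unit_vec i" if "Suc k < length q" for k
    using step[of k] that pq by (simp add: nth_append)
  then have "q \<in> paths (last q)"
    using \<open>q \<noteq> []\<close> p(2) pq by (auto simp: paths_def)
  then show ?thesis
    using that[of i q] bi pq by simp
qed

lemma finite_paths: "finite (paths (\<beta> :: 'r::finite \<Rightarrow> nat))"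
proof (induction \<beta> rule: root_lattice_induct)
  case (step \<beta>)
  show ?case
  proof (cases "\<beta> = 0")
    case False
    have "paths \<beta> \<subseteq> (\<Union>i\<in>{i. 0 < \<beta> i}. (\<lambda>q. q @ [\<beta>]) ` paths (\<beta> - unit_vec i))"
      using path_cases[OF _ False] by blast
    then show ?thesis
      by (rule finite_subset) (auto intro: step)
  qed (auto simp: paths_zero simp del: zero_fun_apply)
qed

text \<open>Removing the last vertex of a path to \<beta> leaves a path to some \<beta> -
  \<alpha>_i, and the endpoint of what is left determines i, so the pieces are disjoint.\<close>

lemma sum_paths:
  fixes \<beta> :: "'r::finite \<Rightarrow> nat"
  assumes "\<beta> \<noteq> 0"
  shows "(\<Sum>p\<in>paths \<beta>. g p) = (\<Sum>i | 0 < \<beta> i. \<Sum>q\<in>paths (\<beta> - unit_vec i). g (q @ [\<beta>]))"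
proof -
  have eq: "paths \<beta> = (\<Union>i\<in>{i. 0 < \<beta> i}. (\<lambda>q. q @ [\<beta>]) ` paths (\<beta> - unit_vec i))"
  proof (rule subset_antisym)
    show "paths \<beta> \<subseteq> (\<Union>i\<in>{i. 0 < \<beta> i}. (\<lambda>q. q @ [\<beta>]) ` paths (\<beta> - unit_vec i))"
    proof
      fix p assume "p \<in> paths \<beta>"
      then obtain q i where "0 < \<beta> i" "q \<in> paths (\<beta> - unit_vec i)" "p = q @ [\<beta>]"
        using path_cases assms by metis
      then show "p \<in> (\<Union>i\<in>{i. 0 < \<beta> i}. (\<lambda>q. q @ [\<beta>]) ` paths (\<beta> - unit_vec i))"
        by blast
    qed
    have "q @ [\<beta>] \<in> paths \<beta>" if "0 < \<beta> i" "q \<in> paths (\<beta> - unit_vec i)" for i q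
      using path_append[OF that(2), of i] by (simp only: diff_unit_vec_add[of \<beta> i, OF that(1)])
    then show "(\<Union>i\<in>{i. 0 < \<beta> i}. (\<lambda>q. q @ [\<beta>]) ` paths (\<beta> - unit_vec i)) \<subseteq> paths \<beta>"
      by (simp add: image_subset_iff UN_subset_iff)
  qed
  have disj: "i = j"
    if "0 < \<beta> i" "0 < \<beta> j" "q \<in> paths (\<beta> - unit_vec i)" "q \<in> paths (\<beta> - unit_vec j)" for i j q
  proof -
    have "\<beta> - unit_vec i = \<beta> - unit_vec j"
      using that(3,4) by (simp add: paths_def)
    \<comment> \<open>At coordinate \<open>i\<close> the left side is smaller than
      \<open>\<beta> i\<close>, because \<open>\<beta> i\<close> is positive; this forces
      \<open>j\<close> = \<open>i\<close>.\<close>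
    then have "(\<beta> - unit_vec i) i = (\<beta> - unit_vec j) i" by (rule fun_cong)
    then show ?thesis
      using that(1) by (auto simp: unit_vec_def split: if_splits)
  qed
  have "(\<Sum>p\<in>paths \<beta>. g p)
      = (\<Sum>i | 0 < \<beta> i. \<Sum>p\<in>(\<lambda>q. q @ [\<beta>]) ` paths (\<beta> - unit_vec i). g p)"
    unfolding eq
  proof (rule sum.UNION_disjoint)
    show "\<forall>i\<in>{i. 0 < \<beta> i}. \<forall>j\<in>{i. 0 < \<beta> i}. i \<noteq> j \<longrightarrow>
        (\<lambda>q. q @ [\<beta>]) ` paths (\<beta> - unit_vec i) \<inter> (\<lambda>q. q @ [\<beta>]) ` paths (\<beta> - unit_vec j) = {}"
      by (blast dest: disj)
  qed (simp_all add: finite_paths)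
  also have "\<dots> = (\<Sum>i | 0 < \<beta> i. \<Sum>q\<in>paths (\<beta> - unit_vec i). g (q @ [\<beta>]))"
    by (rule sum.cong[OF refl], subst sum.reindex) (auto simp: inj_on_def)
  finally show ?thesis .
qed

text \<open>The description \<open>THE\<close> in \<open>step_indices\<close> recovers the index
  because distinct indices have distinct unit vectors.\<close>

lemma step_indices_append:
  assumes "q \<noteq> []"
  shows "step_indices (q @ [last q + unit_vec i]) = step_indices q @ [i]"
  using assms
proof (induction q rule: step_indices.induct)
  case (1 p q ps)
  then show ?case by simp
next
  case ("2_2" v)
  have "(THE j. v + unit_vec i = v + unit_vec j) = i"
    by (rule the_equality) (auto dest: inj_unit_vec)
  then show ?case by (simp del: plus_fun_apply)
qed auto

section \<open>Singular vectors\<close>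

locale chevalley_module = chevalley_data scale bracket H \<alpha> C d e f h form \<omega>
    + lie_module scale bracket scaleV act
  for scale :: "complex \<Rightarrow> 'g::ab_group_add \<Rightarrow> 'g"
    and bracket :: "'g \<Rightarrow> 'g \<Rightarrow> 'g"
    and H :: "'g set"
    and \<alpha> :: "'r::finite \<Rightarrow> 'g \<Rightarrow> complex"
    and C :: "'r \<Rightarrow> 'r \<Rightarrow> int"
    and d :: "'r \<Rightarrow> nat"
    and e f h :: "'r \<Rightarrow> 'g"
    and form :: "('g \<Rightarrow> complex) \<Rightarrow> ('g \<Rightarrow> complex) \<Rightarrow> complex"
    and \<omega> :: "'r \<Rightarrow> 'g \<Rightarrow> complex"
    and scaleV :: "complex \<Rightarrow> 'v::ab_group_add \<Rightarrow> 'v"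
    and act :: "'g \<Rightarrow> 'v \<Rightarrow> 'v"
begin

abbreviation wt :: "('g \<Rightarrow> complex) \<Rightarrow> 'v set" where
  "wt \<equiv> weight_space scaleV act H"

lemma simple_root_dual: "\<alpha> i \<in> dual_of scale H"
  using simple_roots by (auto simp: simple_roots_def roots_def)

lemma qelt_dual: "qelt \<alpha> \<beta> \<in> dual_of scale H"
proof -
  have "qelt \<alpha> \<beta> = (\<Sum>i\<in>UNIV. fscale (of_nat (\<beta> i)) (\<alpha> i))"
    by (simp add: qelt_def fscale_def fun_eq_iff sum_apply)
  then show ?thesis by (auto intro: dual_of_sum dual_of_fscale simple_root_dual)
qed

text \<open>Linear independence of the simple roots makes coordinates unique.\<close>

lemma qelt_eq_iff: "qelt \<alpha> \<beta> = qelt \<alpha> \<gamma> \<longleftrightarrow> \<beta> = \<gamma>"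
proof
  assume eq: "qelt \<alpha> \<beta> = qelt \<alpha> \<gamma>"
  define c where "c i = (of_nat (\<beta> i) - of_nat (\<gamma> i) :: complex)" for i
  have "(\<Sum>i\<in>UNIV. fscale (c i) (\<alpha> i)) = qelt \<alpha> \<beta> - qelt \<alpha> \<gamma>"
    by (simp add: qelt_def fscale_def fun_eq_iff sum_apply c_def left_diff_distrib sum_subtractf)
  then have "c = 0"
    using simple_roots eq by (simp add: simple_roots_def)
  then show "\<beta> = \<gamma>"
    by (simp add: c_def fun_eq_iff)
qed simp

lemma h_in_H: "h i \<in> H"
  using h_basis(3) span_base[of "h i" "range h"] by auto

lemma act_e: "v \<in> wt \<nu> \<Longrightarrow> act (e i) v \<in> wt (\<nu> + \<alpha> i)"
  using act_root_space[OF e_root] .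

lemma act_f: "v \<in> wt \<nu> \<Longrightarrow> act (f i) v \<in> wt (\<nu> - \<alpha> i)"
  using act_root_space[OF f_root] by (metis diff_conv_add_uminus)

lemma act_e_f: "act (e j) (act (f i) v) = act (f i) (act (e j) v) + (if i = j then act (h j) v else 0)"
  by (subst act_swap) (simp add: bracket_ef)

text \<open>The stabilizer of \<open>N\<close> is a subalgebra containing \<open>H\<close> and the
  generators of both nilpotent parts, and by the root space decomposition these span
  everything.\<close>

lemma submodule_if_stable:
  assumes N: "V.subspace N"
    and H: "\<And>t v. t \<in> H \<Longrightarrow> v \<in> N \<Longrightarrow> act t v \<in> N"
    and e: "\<And>i v. v \<in> N \<Longrightarrow> act (e i) v \<in> N"
    and f: "\<And>i v. v \<in> N \<Longrightarrow> act (f i) v \<in> N"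
    and v: "v \<in> N"
  shows "act x v \<in> N"
proof -
  define S where "S = {x. \<forall>v\<in>N. act x v \<in> N}"
  have S: "lie_subalgebra scale bracket S"
    unfolding S_def using N by (rule lie_subalgebra_stabilizer)
  have "lie_subalgebra scale bracket hull range e \<subseteq> S"
    using e by (intro hull_minimal S) (auto simp: S_def)
  then have np: "n_plus scale bracket H \<alpha> \<subseteq> S" by (simp add: e_generate)
  have "lie_subalgebra scale bracket hull range f \<subseteq> S"
    using f by (intro hull_minimal S) (auto simp: S_def)
  then have nm: "n_minus scale bracket H \<alpha> \<subseteq> S" by (simp add: f_generate)
  have "root_space scale bracket H \<phi> \<subseteq> S" if \<phi>: "\<phi> \<in> dual_of scale H" for \<phi>
  proof (cases "\<phi> \<in> roots scale bracket H")
    case True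
    then obtain \<beta> where "\<phi> = qelt \<alpha> \<beta> \<or> \<phi> = - qelt \<alpha> \<beta>"
      using simple_roots unfolding simple_roots_def by blast
    then have "root_space scale bracket H \<phi> \<subseteq> n_plus scale bracket H \<alpha> \<or>
        root_space scale bracket H \<phi> \<subseteq> n_minus scale bracket H \<alpha>"
      using True unfolding n_plus_def n_minus_def
      by (blast intro: span_base)
    then show ?thesis using np nm by blast
  next
    case False
    have "0 \<in> S" by (simp add: S_def V.subspace_0[OF N])
    moreover have "H \<subseteq> S" using H by (auto simp: S_def)
    \<comment> \<open>A functional in the dual that is not a root is either 0, whose root space is
      \<open>H\<close> itself, or has a trivial root space.\<close>
    moreover have "\<phi> = 0 \<or> root_space scale bracket H \<phi> = {0}"
      using False \<phi> by (auto simp: roots_def)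
    ultimately show ?thesis
      using cartan by (auto simp: cartan_subalgebra_def)
  qed
  then have "span (\<Union>\<phi>\<in>dual_of scale H. root_space scale bracket H \<phi>) \<subseteq> S"
    using S by (intro span_minimal) (auto simp: lie_subalgebra_def)
  then have "S = UNIV"
    using cartan by (auto simp: cartan_subalgebra_def)
  then show ?thesis using v by (auto simp: S_def)
qed

text \<open>The head of the list acts last, opposite to the order in \<open>path_vector\<close>, so
  that list induction peels off the outermost operator.\<close>

definition fword :: "'v \<Rightarrow> 'r list \<Rightarrow> 'v" where
  "fword u is = foldr (\<lambda>i. act (f i)) is u"

lemma fword_simps [simp]: "fword u [] = u" "fword u (i # is) = act (f i) (fword u is)"
  by (simp_all add: fword_def)

lemma fword_weight: "u \<in> wt \<nu> \<Longrightarrow> \<exists>\<gamma>. (is \<noteq> [] \<longrightarrow> \<gamma> \<noteq> 0) \<and> fword u is \<in> wt (\<nu> - qelt \<alpha> \<gamma>)"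
proof (induction "is")
  case (Cons i "is")
  then obtain \<gamma> where "fword u is \<in> wt (\<nu> - qelt \<alpha> \<gamma>)" by blast
  from act_f[OF this, of i] have "fword u (i # is) \<in> wt (\<nu> - qelt \<alpha> (\<gamma> + unit_vec i))"
    by (simp only: fword_simps qelt_add qelt_unit_vec diff_diff_eq)
  then show ?case
    using add_unit_vec_neq_0[of \<gamma> i] by (intro exI[of _ "\<gamma> + unit_vec i"] conjI impI)
qed (intro exI[of _ 0], simp del: zero_fun_apply)

text \<open>\<open>H\<close> rescales each word, the \<open>f i\<close> lengthen words, and
  \<open>e i\<close> moves past each \<open>f j\<close> at the cost of an \<open>h j\<close> term
  until it meets \<open>u\<close>, which it kills.\<close>

lemma singular_submodule:
  assumes u: "u \<in> wt \<nu>" "\<And>i. act (e i) u = 0" and v: "v \<in> V.span (range (fword u))"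
  shows "act x v \<in> V.span (range (fword u))"
proof (rule submodule_if_stable[OF V.subspace_span _ _ _ v])
  let ?N = "V.span (range (fword u))"
  have h: "act t (fword u is) \<in> ?N" if "t \<in> H" for t "is"
  proof -
    obtain \<gamma> where "fword u is \<in> wt (\<nu> - qelt \<alpha> \<gamma>)" using fword_weight[OF u(1)] by blast
    then have "act t (fword u is) = scaleV ((\<nu> - qelt \<alpha> \<gamma>) t) (fword u is)"
      using that by (rule weight_spaceD)
    then show ?thesis by (metis V.span_base V.span_scale rangeI)
  qed
  then show "act t v \<in> ?N" if "t \<in> H" "v \<in> ?N" for t v
    using act_in_span[OF that(2)] that(1) by blast
  have f1: "act (f i) v \<in> ?N" if "v \<in> ?N" for i v
  proof (rule act_in_span[OF that])
    fix b assume "b \<in> range (fword u)"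
    then obtain "is" where "b = fword u is" by blast
    then have "act (f i) b = fword u (i # is)" by simp
    then show "act (f i) b \<in> ?N" by (metis V.span_base rangeI)
  qed
  then show "act (f i) v \<in> ?N" if "v \<in> ?N" for i v
    using that by blast
  have "act (e i) (fword u is) \<in> ?N" for i "is"
  proof (induction "is")
    case Nil
    then show ?case by (simp add: u(2) V.span_zero)
  next
    case (Cons j "is")
    then show ?case
      by (auto simp: act_e_f intro!: V.span_add f1 h h_in_H)
  qed
  then show "act (e i) v \<in> ?N" if "v \<in> ?N" for i v
    using act_in_span[OF that] by blast
qed

end

section \<open>Irreducible highest weight modules\<close>

locale irreducible_highest_weight_module =
  chevalley_module scale bracket H \<alpha> C d e f h form \<omega> scaleV act
  for scale :: "complex \<Rightarrow> 'g::ab_group_add \<Rightarrow> 'g"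
    and bracket :: "'g \<Rightarrow> 'g \<Rightarrow> 'g"
    and H :: "'g set"
    and \<alpha> :: "'r::finite \<Rightarrow> 'g \<Rightarrow> complex"
    and C :: "'r \<Rightarrow> 'r \<Rightarrow> int"
    and d :: "'r \<Rightarrow> nat"
    and e f h :: "'r \<Rightarrow> 'g"
    and form :: "('g \<Rightarrow> complex) \<Rightarrow> ('g \<Rightarrow> complex) \<Rightarrow> complex"
    and \<omega> :: "'r \<Rightarrow> 'g \<Rightarrow> complex"
    and scaleV :: "complex \<Rightarrow> 'v::ab_group_add \<Rightarrow> 'v"
    and act :: "'g \<Rightarrow> 'v \<Rightarrow> 'v" +
  fixes \<Lambda> :: "'g \<Rightarrow> complex" and v0 :: 'v
  assumes weight_dual: "\<Lambda> \<in> dual_of scale H"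
    and irreducible: "irreducible_module scaleV act"
    and v0_neq_0: "v0 \<noteq> 0"
    and v0_weight: "v0 \<in> wt \<Lambda>"
    and act_e_v0: "act (e i) v0 = 0"
begin

text \<open>The sum of all weight spaces strictly below \<Lambda>. It serves as the complement of
  the line through \<open>v0\<close>, the hyperplane on which \<open>bra\<close> vanishes.\<close>

definition lower :: "'v set" where
  "lower = V.span (\<Union>\<nu>\<in>{\<Lambda> - qelt \<alpha> \<beta> | \<beta>. \<beta> \<noteq> 0}. wt \<nu>)"

lemma weight_below_dual: "\<Lambda> - qelt \<alpha> \<beta> \<in> dual_of scale H"
  by (intro dual_of_diff weight_dual qelt_dual)

text \<open>The span is a submodule by \<open>singular_submodule\<close> and contains the nonzero
  \<open>u\<close>, so irreducibility leaves only the whole module.\<close>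

lemma singular_span_UNIV:
  assumes "u \<in> wt \<nu>" "\<And>i. act (e i) u = 0" "u \<noteq> 0"
  shows "V.span (range (fword u)) = UNIV"
proof -
  have "u \<in> V.span (range (fword u))"
    by (metis V.span_base fword_simps(1) rangeI)
  moreover have "V.span (range (fword u)) = {0} \<or> V.span (range (fword u)) = UNIV"
    using irreducible singular_submodule[OF assms(1,2)] V.subspace_span
    unfolding irreducible_module_def by blast
  ultimately show ?thesis using assms(3) by auto
qed

lemma subspace_lower: "V.subspace lower"
  by (simp add: lower_def)

lemma wt_subset_lower: "\<beta> \<noteq> 0 \<Longrightarrow> wt (\<Lambda> - qelt \<alpha> \<beta>) \<subseteq> lower"
  unfolding lower_def by (blast intro: V.span_base)

text \<open>\<Lambda> differs from every strictly lower weight by \<open>qelt_eq_iff\<close>, so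
  independence of weight spaces applies.\<close>

lemma wt_inter_lower: "v \<in> wt \<Lambda> \<Longrightarrow> v \<in> lower \<Longrightarrow> v = 0"
proof (rule weight_space_disjoint_span[where \<nu> = \<Lambda> and H = H and S = "{\<Lambda> - qelt \<alpha> \<beta> | \<beta>. \<beta> \<noteq> 0}"])
  show "\<Lambda> \<notin> {\<Lambda> - qelt \<alpha> \<beta> | \<beta>. \<beta> \<noteq> 0}"
  proof
    assume "\<Lambda> \<in> {\<Lambda> - qelt \<alpha> \<beta> | \<beta>. \<beta> \<noteq> 0}"
    then obtain \<beta> where "\<beta> \<noteq> 0" "qelt \<alpha> \<beta> = qelt \<alpha> 0" by auto
    then show False by (simp only: qelt_eq_iff)
  qed
qed (use weight_below_dual weight_dual in \<open>auto simp: lower_def\<close>)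

lemma v0_notin_lower: "v0 \<notin> lower"
  using wt_inter_lower v0_weight v0_neq_0 by blast

text \<open>The words applied to \<open>v0\<close> span the module, and every nonempty word falls
  into \<open>lower\<close>.\<close>

lemma decompose: "\<exists>c. v - scaleV c v0 \<in> lower"
proof -
  have "range (fword v0) \<subseteq> insert v0 lower"
  proof
    fix x assume "x \<in> range (fword v0)"
    then obtain "is" where x: "x = fword v0 is" by blast
    show "x \<in> insert v0 lower"
    proof (cases "is")
      case (Cons i js)
      then show ?thesis
        using fword_weight[OF v0_weight, of "is"] wt_subset_lower x by blast
    qed (simp add: x)
  qed
  then have "v \<in> V.span (insert v0 lower)"
    using singular_span_UNIV[OF v0_weight act_e_v0 v0_neq_0] V.span_mono by blast
  then show ?thesis
    by (simp add: V.span_breakdown_eq V.span_eq_iff[THEN iffD2, OF subspace_lower])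
qed

text \<open>Words applied to \<open>v0\<close> span the module and all have weights \<Lambda> -
  \<beta>, which by independence leaves no room for other weights.\<close>

lemma wt_zero:
  assumes "\<nu> \<in> dual_of scale H" "\<And>\<beta>. \<nu> \<noteq> \<Lambda> - qelt \<alpha> \<beta>" "v \<in> wt \<nu>"
  shows "v = 0"
proof (rule weight_space_disjoint_span[OF _ assms(1) _ assms(3)])
  let ?S = "range (\<lambda>\<beta>. \<Lambda> - qelt \<alpha> \<beta>)"
  show "?S \<subseteq> dual_of scale H" using weight_below_dual by blast
  show "\<nu> \<notin> ?S" using assms(2) by blast
  have "range (fword v0) \<subseteq> (\<Union>\<kappa>\<in>?S. wt \<kappa>)"
    using fword_weight[OF v0_weight] by blast
  then show "v \<in> V.span (\<Union>\<kappa>\<in>?S. wt \<kappa>)"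
    using singular_span_UNIV[OF v0_weight act_e_v0 v0_neq_0] V.span_mono by blast
qed

text \<open>The image would have weight \<Lambda> - (\<beta> - \<alpha>_i), where \<beta> -
  \<alpha>_i has a negative coordinate.\<close>

lemma act_e_eq_0:
  assumes "v \<in> wt (\<Lambda> - qelt \<alpha> \<beta>)" "\<beta> i = 0"
  shows "act (e i) v = 0"
proof (rule wt_zero[OF _ _ act_e[OF assms(1)]])
  show "\<Lambda> - qelt \<alpha> \<beta> + \<alpha> i \<in> dual_of scale H"
    by (intro dual_of_add weight_below_dual simple_root_dual)
  show "\<Lambda> - qelt \<alpha> \<beta> + \<alpha> i \<noteq> \<Lambda> - qelt \<alpha> \<gamma>" for \<gamma>
  proof
    assume "\<Lambda> - qelt \<alpha> \<beta> + \<alpha> i = \<Lambda> - qelt \<alpha> \<gamma>"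
    then have "qelt \<alpha> (\<gamma> + unit_vec i) = qelt \<alpha> \<beta>"
      by (simp add: qelt_add) (simp add: algebra_simps)
    then have "\<beta> = \<gamma> + unit_vec i" by (simp only: qelt_eq_iff)
    then show False using assms(2) by simp
  qed
qed

text \<open>A nonzero \<open>u\<close> of this kind would generate a submodule inside
  \<open>lower\<close>, which misses \<open>v0\<close>, although irreducibility makes it
  everything.\<close>

lemma singular_below_eq_0:
  assumes u: "u \<in> wt (\<Lambda> - qelt \<alpha> \<beta>)" and "\<beta> \<noteq> 0" "\<And>i. act (e i) u = 0"
  shows "u = 0"
proof (rule ccontr)
  assume "u \<noteq> 0"
  have "fword u is \<in> lower" for "is"
  proof -
    obtain \<gamma> where "fword u is \<in> wt (\<Lambda> - qelt \<alpha> \<beta> - qelt \<alpha> \<gamma>)"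
      using fword_weight[OF u] by blast
    then have "fword u is \<in> wt (\<Lambda> - qelt \<alpha> (\<beta> + \<gamma>))"
      by (simp only: qelt_add diff_diff_eq)
    moreover have "\<beta> + \<gamma> \<noteq> 0"
      using \<open>\<beta> \<noteq> 0\<close> by (auto simp: fun_eq_iff)
    ultimately show ?thesis using wt_subset_lower by blast
  qed
  then have "V.span (range (fword u)) \<subseteq> lower"
    by (intro V.span_minimal subspace_lower) auto
  then show False
    using singular_span_UNIV[OF u assms(3) \<open>u \<noteq> 0\<close>] v0_notin_lower by blast
qed

section \<open>The highest weight functional\<close>

abbreviation bra_v0 :: "'v \<Rightarrow> complex" where
  "bra_v0 \<equiv> bra scaleV act H \<alpha> \<Lambda> v0"

text \<open>\<open>bra\<close> is a definite description, so existence and uniqueness come first.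
  Any admissible functional kills \<open>lower\<close>, hence reads off the coefficient of
  \<open>v0\<close> modulo \<open>lower\<close>; taking that coefficient is itself
  admissible.\<close>

lemma bra_eq:
  assumes "v - scaleV c v0 \<in> lower"
  shows "bra_v0 v = c"
proof -
  let ?P = "\<lambda>\<phi>. Vector_Spaces.linear scaleV (*) \<phi> \<and> \<phi> v0 = 1 \<and>
    (\<forall>\<beta>. \<beta> \<noteq> 0 \<longrightarrow> (\<forall>v \<in> wt (\<Lambda> - qelt \<alpha> \<beta>). \<phi> v = 0))"
  have P_eq: "\<phi> v = c" if P: "?P \<phi>" and v: "v - scaleV c v0 \<in> lower" for \<phi> v c
  proof -
    interpret \<phi>: Vector_Spaces.linear scaleV "(*)" \<phi> using P by blast
    have "lower \<subseteq> {v. \<phi> v = 0}"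
      unfolding lower_def using P
      by (intro V.span_minimal V.subspaceI) (auto simp: \<phi>.add \<phi>.scale \<phi>.zero)
    then have "\<phi> (v - scaleV c v0) = 0" using v by blast
    then show ?thesis using P by (simp add: \<phi>.diff \<phi>.scale)
  qed
  have coeff_unique: "a = b" if "v - scaleV a v0 \<in> lower" "v - scaleV b v0 \<in> lower" for v a b
  proof (rule ccontr)
    assume "a \<noteq> b"
    have "scaleV (b - a) v0 \<in> lower"
      using V.subspace_diff[OF subspace_lower that] by (simp add: V.scale_left_diff_distrib)
    \<comment> \<open>Rescaling by the inverse would put \<open>v0\<close> itself into
      \<open>lower\<close>.\<close>
    then have "scaleV (inverse (b - a)) (scaleV (b - a) v0) \<in> lower"
      by (rule V.subspace_scale[OF subspace_lower])
    then show False using \<open>a \<noteq> b\<close> v0_notin_lower by simp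
  qed
  \<comment> \<open>A chosen coefficient of \<open>v0\<close> modulo \<open>lower\<close>; linearity
    will follow because the coefficient is unique.\<close>
  define \<psi> where "\<psi> v = (SOME c. v - scaleV c v0 \<in> lower)" for v
  have \<psi>: "v - scaleV (\<psi> v) v0 \<in> lower" for v
    unfolding \<psi>_def using decompose by (rule someI_ex)
  have \<psi>_eq: "\<psi> v = c" if "v - scaleV c v0 \<in> lower" for v c
    using coeff_unique \<psi> that by blast
  have "vector_space ((*) :: complex \<Rightarrow> complex \<Rightarrow> complex)"
    by unfold_locales (auto simp: algebra_simps)
  moreover have "\<psi> (x + y) = \<psi> x + \<psi> y" for x y
    using V.subspace_add[OF subspace_lower \<psi>[of x] \<psi>[of y]]
    by (intro \<psi>_eq) (simp add: V.scale_left_distrib algebra_simps)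
  moreover have "\<psi> (scaleV r x) = r * \<psi> x" for r x
    using V.subspace_scale[OF subspace_lower \<psi>[of x], of r]
    by (intro \<psi>_eq) (simp add: V.scale_right_diff_distrib)
  ultimately have "Vector_Spaces.linear scaleV (*) \<psi>"
    using V.vector_space_axioms by (simp add: Vector_Spaces.linear_iff)
  moreover have "\<psi> v0 = 1"
    by (rule \<psi>_eq) (simp add: V.subspace_0[OF subspace_lower])
  moreover have "\<psi> v = 0" if "\<beta> \<noteq> 0" "v \<in> wt (\<Lambda> - qelt \<alpha> \<beta>)" for \<beta> v
    using wt_subset_lower[OF that(1)] that(2) by (intro \<psi>_eq) auto
  ultimately have "?P \<psi>" by blast
  moreover have "\<phi> = \<psi>" if "?P \<phi>" for \<phi>
    using P_eq[OF that \<psi>] by blast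
  ultimately have "?P bra_v0"
    unfolding bra_def by (rule theI[where P = ?P])
  from P_eq[OF this assms] show ?thesis .
qed

lemma bra_v0_v0: "bra_v0 v0 = 1"
  by (rule bra_eq) (simp add: V.subspace_0[OF subspace_lower])

text \<open>Subtracting the \<open>v0\<close> part leaves a vector both of weight \<Lambda> and in
  \<open>lower\<close>, which is 0.\<close>

lemma wt_highest:
  assumes "v \<in> wt \<Lambda>"
  shows "v = scaleV (bra_v0 v) v0"
proof -
  obtain c where c: "v - scaleV c v0 \<in> lower" using decompose by blast
  have "v - scaleV c v0 \<in> wt \<Lambda>"
    by (intro V.subspace_diff V.subspace_scale subspace_weight_space assms v0_weight)
  from wt_inter_lower[OF this c] have "v = scaleV c v0" by simp
  with bra_eq[OF c] show ?thesis by simp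
qed

section \<open>Uniqueness of the Whittaker vector\<close>

lemma whittaker_vector_unique:
  assumes "whittaker_vector scaleV act H \<alpha> e \<Lambda> v0 \<mu> w" "whittaker_vector scaleV act H \<alpha> e \<Lambda> v0 \<mu> w'"
  shows "w \<beta> = w' \<beta>"
proof (induction \<beta> rule: root_lattice_induct)
  case (step \<beta>)
  have wt: "x \<gamma> \<in> wt (\<Lambda> - qelt \<alpha> \<gamma>)" and bra: "bra_v0 (x 0) = 1"
    and e: "act (e i) (x (\<gamma> + unit_vec i)) = scaleV (\<mu> i) (x \<gamma>)"
    if "x \<in> {w, w'}" for x \<gamma> i
    using that assms
    by (auto simp: whittaker_vector_def completion_def bra_completion_def raise_def dest!: fun_cong spec)
  show ?case
  proof (cases "\<beta> = 0")
    case True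
    \<comment> \<open>The top weight space is the line through \<open>v0\<close>, and the
      normalization fixes the scalar.\<close>
    have "x 0 = v0" if "x \<in> {w, w'}" for x
      using wt_highest[of "x 0"] wt[OF that, of 0] bra[OF that] by (simp add: diff_zero del: zero_fun_apply)
    then show ?thesis using True by blast
  next
    case False
    have diff: "w \<beta> - w' \<beta> \<in> wt (\<Lambda> - qelt \<alpha> \<beta>)"
      by (intro V.subspace_diff[OF subspace_weight_space] wt) auto
    have "act (e i) (w \<beta> - w' \<beta>) = 0" for i
    proof (cases "\<beta> i = 0")
      \<comment> \<open>There is no component at \<beta> - \<alpha>_i here, so the eigenvalue
        equation is silent and the weight argument takes over.\<close>
      case True
      then show ?thesis using act_e_eq_0[OF diff] by blast
    next
      case False
      then have pos: "0 < \<beta> i" by simp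
      \<comment> \<open>The eigenvalue equation at \<beta> - \<alpha>_i expresses both images
        through components that agree by induction.\<close>
      have "act (e i) (w \<beta>) = scaleV (\<mu> i) (w (\<beta> - unit_vec i))"
        "act (e i) (w' \<beta>) = scaleV (\<mu> i) (w' (\<beta> - unit_vec i))"
        using e[of w i "\<beta> - unit_vec i"] e[of w' i "\<beta> - unit_vec i"]
        unfolding diff_unit_vec_add[of \<beta> i, OF pos] by simp_all
      then show ?thesis by (simp only: act_diff_right step[OF pos] diff_self)
    qed
    then show ?thesis using singular_below_eq_0[OF diff False] by simp
  qed
qed

section \<open>The vectors \<open>Z\<^sub>\<beta>\<close>\<close>

abbreviation vw :: "('r \<Rightarrow> nat) \<Rightarrow> complex" where
  "vw \<equiv> vertex_weight form \<alpha> \<omega> \<Lambda>"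

text \<open>\<alpha>_j is d_j times its co-root, and pairing with the co-root is evaluation at
  \<open>h j\<close>.\<close>

lemma form_simple_root:
  assumes "\<phi> \<in> dual_of scale H"
  shows "form \<phi> (\<alpha> j) = of_nat (d j) * \<phi> (h j)"
proof -
  have cd: "coroot \<alpha> d j \<in> dual_of scale H"
    unfolding coroot_def by (intro dual_of_fscale simple_root_dual)
  have "\<alpha> j = fscale (of_nat (d j)) (coroot \<alpha> d j)"
    using d_pos[of j] by (simp add: coroot_def fscale_def fun_eq_iff)
  then have "form \<phi> (\<alpha> j) = form (fscale (of_nat (d j)) (coroot \<alpha> d j)) \<phi>"
    using form_sym[OF assms simple_root_dual] by metis
  also have "\<dots> = of_nat (d j) * form \<phi> (coroot \<alpha> d j)"
    by (simp add: form_scale[OF cd assms] form_sym[OF cd assms])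
  finally show ?thesis by (simp add: form_coroot[OF assms])
qed

lemma form_add_right:
  "\<phi> \<in> dual_of scale H \<Longrightarrow> \<psi> \<in> dual_of scale H \<Longrightarrow> \<chi> \<in> dual_of scale H \<Longrightarrow>
    form \<phi> (\<psi> + \<chi>) = form \<phi> \<psi> + form \<phi> \<chi>"
  by (metis form_add form_sym dual_of_add)

lemma rho_dual: "rho \<omega> \<in> dual_of scale H"
  unfolding rho_def by (intro dual_of_sum omega_dual)

lemma rho_h: "rho \<omega> (h j) = 1"
  by (simp add: rho_def sum_apply form_coroot[OF omega_dual] omega_coroot)

text \<open>The \<rho>-shift contributes d_j, which cancels half of (\<alpha>_j|\<alpha>_j) = 2 d_j;
  only the value of \<Lambda> - \<beta> on \<open>h j\<close> survives.\<close>

lemma vertex_weight_step: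
  "vw (\<beta> + unit_vec j) = vw \<beta> + of_nat (d j) * (\<Lambda> - qelt \<alpha> \<beta>) (h j)"
proof -
  let ?b = "qelt \<alpha> \<beta>" and ?L = "\<Lambda> + rho \<omega>"
  have L: "?L \<in> dual_of scale H" by (intro dual_of_add weight_dual rho_dual)
  have b: "?b \<in> dual_of scale H" and a: "\<alpha> j \<in> dual_of scale H"
    by (rule qelt_dual simple_root_dual)+
  have ba: "?b + \<alpha> j \<in> dual_of scale H" by (intro dual_of_add a b)
  have 1: "form ?L (?b + \<alpha> j) = form ?L ?b + of_nat (d j) * (\<Lambda> (h j) + 1)"
    by (simp only: form_add_right[OF L b a] form_simple_root[OF L] plus_fun_apply rho_h)
  have "form (?b + \<alpha> j) (?b + \<alpha> j) = form ?b ?b + form ?b (\<alpha> j) + (form ?b (\<alpha> j) + form (\<alpha> j) (\<alpha> j))"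
    by (simp only: form_add[OF b a ba] form_add_right[OF b b a] form_add_right[OF a b a] form_sym[OF a b])
  also have "\<dots> = form ?b ?b + 2 * of_nat (d j) * ?b (h j) + 2 * of_nat (d j)"
    using cartan_matrix
    by (simp add: form_simple_root a b root_h generalized_cartan_matrix_def)
  finally show ?thesis
    unfolding vertex_weight_def qelt_add qelt_unit_vec 1 by (simp add: algebra_simps)
qed

section \<open>Recursion and weights of the vectors \<open>Z\<close>\<close>

abbreviation Z :: "('r \<Rightarrow> nat) \<Rightarrow> 'v" where
  "Z \<equiv> Z_vector scaleV act f v0 vw"

lemma Z_0: "Z 0 = v0"
  by (simp add: Z_vector_def paths_zero path_weight_def path_vector_def del: zero_fun_apply)

lemma path_vector_append:
  assumes "q \<in> paths \<beta>"
  shows "path_vector act f v0 (q @ [\<beta> + unit_vec i]) = act (f i) (path_vector act f v0 q)"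
proof -
  have q: "q \<noteq> []" "\<beta> = last q" using assms by (auto simp: paths_def)
  show ?thesis
    unfolding path_vector_def q(2) step_indices_append[OF q(1)] by simp
qed

text \<open>A path is nonempty, so the appended vertex lies in the tail over which the product
  runs.\<close>

lemma path_weight_append: "q \<in> paths \<beta> \<Longrightarrow> path_weight v (q @ [\<gamma>]) = 1 / v \<gamma> * path_weight v q"
  by (cases q) (auto simp: path_weight_def paths_def)

text \<open>Paths are grouped by their last step \<alpha>_i: the final vertex \<beta> contributes
  1/v(\<beta>), and the step contributes f_i as the outermost operator.\<close>

lemma Z_recursion:
  assumes "\<beta> \<noteq> 0"
  shows "Z \<beta> = scaleV (1 / vw \<beta>) (\<Sum>i | 0 < \<beta> i. act (f i) (Z (\<beta> - unit_vec i)))"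
proof -
  have "scaleV (path_weight vw (q @ [\<beta>])) (path_vector act f v0 (q @ [\<beta>])) =
      scaleV (1 / vw \<beta>) (act (f i) (scaleV (path_weight vw q) (path_vector act f v0 q)))"
    if "0 < \<beta> i" "q \<in> paths (\<beta> - unit_vec i)" for i q
    using path_vector_append[OF that(2), of i] path_weight_append[OF that(2), of vw \<beta>]
    unfolding diff_unit_vec_add[of \<beta> i, OF that(1)] by (simp add: act_scale_right)
  then show ?thesis
    unfolding Z_vector_def sum_paths[OF assms] act_sum_right V.scale_sum_right
    by (intro sum.cong) auto
qed

lemma Z_weight: "Z \<beta> \<in> wt (\<Lambda> - qelt \<alpha> \<beta>)"
proof (induction \<beta> rule: root_lattice_induct)
  case (step \<beta>)
  show ?case
  proof (cases "\<beta> = 0")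
    case True
    then show ?thesis
      using v0_weight Z_0 by (metis diff_zero qelt_zero)
  next
    case False
    have "act (f i) (Z (\<beta> - unit_vec i)) \<in> wt (\<Lambda> - qelt \<alpha> \<beta>)" if pos: "0 < \<beta> i" for i
    proof -
      have "qelt \<alpha> \<beta> = qelt \<alpha> (\<beta> - unit_vec i) + \<alpha> i"
        by (metis diff_unit_vec_add[of \<beta> i, OF pos] qelt_add qelt_unit_vec)
      then show ?thesis
        using act_f[OF step[OF pos], of i] by (simp only: diff_diff_eq)
    qed
    then show ?thesis
      unfolding Z_recursion[OF False]
      by (intro V.subspace_scale V.subspace_sum subspace_weight_space) (simp only: mem_Collect_eq)
  qed
qed

section \<open>The Whittaker property for nonvanishing vertex weights\<close>

context
  assumes vw_neq_0: "\<And>\<beta>. \<beta> \<noteq> 0 \<Longrightarrow> vw \<beta> \<noteq> 0"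
begin

text \<open>Clearing the denominator makes the recursion valid also at \<beta> = 0, where v(0) = 0
  and the sum is empty; \<open>act_e_Z\<close> then needs no base case.\<close>

lemma vw_Z: "scaleV (vw \<beta>) (Z \<beta>) = (\<Sum>i | 0 < \<beta> i. act (f i) (Z (\<beta> - unit_vec i)))"
proof (cases "\<beta> = 0")
  case True
  have 0: "(0 :: 'g \<Rightarrow> complex) \<in> dual_of scale H" by (simp add: dual_of_def)
  have z: "form (0 :: 'g \<Rightarrow> complex) \<phi> = 0" if "\<phi> \<in> dual_of scale H" for \<phi>
    using form_add[OF 0 0 that] by (metis add_0 add_cancel_left_right)
  have "vw 0 = 0"
    unfolding vertex_weight_def qelt_zero
    by (metis (no_types, lifting) 0 z form_sym dual_of_add weight_dual rho_dual mult_zero_right diff_zero)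
  then show ?thesis using True by simp
next
  case False
  then show ?thesis
    using vw_neq_0[OF False] by (subst Z_recursion) auto
qed

text \<open>In e_j f_i the commutator contributes only for i = j, giving (\<Lambda> - \<beta>)(h_j)
  Z_\<beta>; the terms f_i e_j reassemble by induction to v(\<beta>) Z_\<beta> / d_j. By
  \<open>vertex_weight_step\<close> the total is v(\<beta> + \<alpha>_j) Z_\<beta> / d_j, and the
  vertex weight cancels.\<close>

lemma act_e_Z: "act (e j) (Z (\<beta> + unit_vec j)) = scaleV (1 / of_nat (d j)) (Z \<beta>)"
proof (induction \<beta> rule: root_lattice_induct)
  case (step \<beta>)
  let ?g = "\<beta> + unit_vec j" and ?c = "1 / of_nat (d j) :: complex"
  let ?A = "{i. 0 < ?g i}"
  have g: "?g \<noteq> 0" by (rule add_unit_vec_neq_0)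
  have dj: "of_nat (d j) \<noteq> (0 :: complex)" using d_pos[of j] by simp
  have fe: "act (f i) (act (e j) (Z (?g - unit_vec i)))
      = (if 0 < \<beta> i then scaleV ?c (act (f i) (Z (\<beta> - unit_vec i))) else 0)"
    if "i \<in> ?A" for i
  proof (cases "0 < \<beta> i")
    case True
    have "?g - unit_vec i = (\<beta> - unit_vec i) + unit_vec j"
      using True by (auto simp: fun_eq_iff unit_vec_def)
    then show ?thesis using True step[OF True] by (simp only: act_scale_right if_True)
  next
    \<comment> \<open>Only \<open>i\<close> = \<open>j\<close> with \<open>\<beta> j\<close> = 0 is
      left; there \<open>e j\<close> kills Z_\<beta> for weight reasons.\<close>
    case False
    then have "i = j" using that by (auto simp: unit_vec_def split: if_splits)
    then have "act (e j) (Z (?g - unit_vec i)) = 0"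
      using False by (simp only: add_unit_vec_diff) (simp add: act_e_eq_0[OF Z_weight])
    then show ?thesis using False by simp
  qed
  have "scaleV (vw ?g) (act (e j) (Z ?g)) = (\<Sum>i\<in>?A. act (e j) (act (f i) (Z (?g - unit_vec i))))"
    by (simp only: vw_Z act_sum_right flip: act_scale_right)
  also have "\<dots> = (\<Sum>i\<in>?A. if 0 < \<beta> i then scaleV ?c (act (f i) (Z (\<beta> - unit_vec i))) else 0)
      + (\<Sum>i\<in>?A. if i = j then act (h j) (Z (?g - unit_vec i)) else 0)"
    by (simp only: act_e_f sum.distrib) (intro arg_cong2[where f = "(+)"] sum.cong refl fe)
  \<comment> \<open>\<open>j\<close> always lies in \<open>?A\<close>, and removing
    \<open>unit_vec j\<close> from \<open>?g\<close> returns \<beta>.\<close>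
  also have "(\<Sum>i\<in>?A. if i = j then act (h j) (Z (?g - unit_vec i)) else 0) = act (h j) (Z \<beta>)"
    by (subst sum.delta) (simp_all del: plus_fun_apply, simp)
  also have "act (h j) (Z \<beta>) = scaleV ((\<Lambda> - qelt \<alpha> \<beta>) (h j)) (Z \<beta>)"
    using Z_weight h_in_H by (rule weight_spaceD)
  \<comment> \<open>\<open>?A\<close> is the support of \<beta> together with \<open>j\<close>, and
    terms outside the support are 0.\<close>
  also have "(\<Sum>i\<in>?A. if 0 < \<beta> i then scaleV ?c (act (f i) (Z (\<beta> - unit_vec i))) else 0)
      = (\<Sum>i | 0 < \<beta> i. scaleV ?c (act (f i) (Z (\<beta> - unit_vec i))))"
    by (intro sum.mono_neutral_cong_right) auto
  also have "\<dots> = scaleV (?c * vw \<beta>) (Z \<beta>)"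
    by (simp only: vw_Z flip: V.scale_sum_right V.scale_scale)
  also have "scaleV (?c * vw \<beta>) (Z \<beta>) + scaleV ((\<Lambda> - qelt \<alpha> \<beta>) (h j)) (Z \<beta>)
      = scaleV (vw ?g) (scaleV ?c (Z \<beta>))"
    using dj by (simp add: vertex_weight_step field_simps flip: V.scale_left_distrib)
  finally show ?case
    using vw_neq_0[OF g] by (simp only: V.scale_cancel_left) blast
qed

text \<open>Adding \<alpha>_j to the index multiplies the coefficient by d_j \<mu>_j; the 1/d_j of
  \<open>act_e_Z\<close> cancels d_j and leaves the eigenvalue \<mu>_j.\<close>

lemma whittaker_vector_Z:
  "whittaker_vector scaleV act H \<alpha> e \<Lambda> v0 \<mu>
    (\<lambda>\<beta>. scaleV (\<Prod>i\<in>UNIV. (of_nat (d i) * \<mu> i) ^ \<beta> i) (Z \<beta>))"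
proof -
  define m where "m \<beta> = (\<Prod>i\<in>UNIV. (of_nat (d i) * \<mu> i) ^ \<beta> i)" for \<beta>
  have m_0: "m 0 = 1" by (simp add: m_def)
  have m_step: "m (\<beta> + unit_vec j) = m \<beta> * (of_nat (d j) * \<mu> j)" for \<beta> j
  proof -
    have "(\<Prod>i\<in>UNIV. (of_nat (d i) * \<mu> i) ^ unit_vec j i)
        = (\<Prod>i\<in>UNIV. if i = j then of_nat (d i) * \<mu> i else 1)"
      by (intro prod.cong) (auto simp: unit_vec_def)
    then show ?thesis by (simp add: m_def power_add prod.distrib)
  qed
  have "raise act e j (\<lambda>\<beta>. scaleV (m \<beta>) (Z \<beta>)) = (\<lambda>\<beta>. scaleV (\<mu> j) (scaleV (m \<beta>) (Z \<beta>)))" for j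
    using d_pos[of j]
    by (simp add: raise_def act_scale_right act_e_Z m_step mult.commute del: plus_fun_apply)
  moreover have "scaleV (m \<beta>) (Z \<beta>) \<in> wt (\<Lambda> - qelt \<alpha> \<beta>)" for \<beta>
    by (intro V.subspace_scale subspace_weight_space Z_weight)
  ultimately show ?thesis
    unfolding m_def[symmetric] whittaker_vector_def
    by (simp add: completion_def bra_completion_def m_0 Z_0 bra_v0_v0 del: zero_fun_apply)
qed

end

end

section \<open>Whittaker vectors in Verma modules\<close>

lemma apply_words_zero:
  assumes "lie_module scale bracket scaleV act"
  shows "apply_words scaleV act 0 p = 0"
proof -
  interpret lie_module scale bracket scaleV act by (rule assms)
  have "foldr act u 0 = 0" for u by (induction u) auto
  then show ?thesis by (simp add: apply_words_def)
qed

lemma apply_words_word: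
  assumes "lie_module scale bracket scaleV act"
  shows "apply_words scaleV act v (word u) = foldr act u v"
proof -
  interpret lie_module scale bracket scaleV act by (rule assms)
  show ?thesis by (simp add: apply_words_def)
qed

lemma lookup_word_scale: "Poly_Mapping.lookup (word_scale c p) u = c * Poly_Mapping.lookup p u"
  by (simp add: word_scale_def Poly_Mapping.map.rep_eq when_def)

lemma word_scale_module: "module word_scale"
  by unfold_locales
    (auto intro!: poly_mapping_eqI simp: lookup_word_scale lookup_add algebra_simps)

text \<open>The defining relations with empty prefix word act on \<open>v0\<close> itself. If
  \<open>v0\<close> were 0, everything it generates, hence the module, would be 0.\<close>

lemma verma_highest_weight:
  assumes "verma_module scale bracket H \<alpha> \<Lambda> scaleV act v0"
  shows "v0 \<in> weight_space scaleV act H \<Lambda>"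
    and "x \<in> n_plus scale bracket H \<alpha> \<Longrightarrow> act x v0 = 0"
    and "irreducible_module scaleV act \<Longrightarrow> v0 \<noteq> 0"
proof -
  have lm: "lie_module scale bracket scaleV act"
    and gen: "range (apply_words scaleV act v0) = UNIV"
    and ker: "{p. apply_words scaleV act v0 p = 0} =
       module.span word_scale (verma_relations scale bracket H \<alpha> \<Lambda>)"
    using assms by (auto simp: verma_module_def)
  interpret lie_module scale bracket scaleV act by (rule lm)
  interpret W: module word_scale by (rule word_scale_module)
  have rel: "apply_words scaleV act v0 p = 0" if "p \<in> verma_relations scale bracket H \<alpha> \<Lambda>" for p
    using ker W.span_base[OF that] by auto
  show "act x v0 = 0" if "x \<in> n_plus scale bracket H \<alpha>" for x
  proof -
    have "word ([] @ [x]) \<in> verma_relations scale bracket H \<alpha> \<Lambda>"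
      using that unfolding verma_relations_def by blast
    from rel[OF this] show ?thesis by (simp add: apply_words_word[OF lm])
  qed
  have "act t v0 = scaleV (\<Lambda> t) v0" if "t \<in> H" for t
  proof -
    have "word ([] @ [t]) - word_scale (\<Lambda> t) (word []) \<in> verma_relations scale bracket H \<alpha> \<Lambda>"
      using that unfolding verma_relations_def by blast
    from rel[OF this]
    have "apply_words scaleV act v0 (word [t] - Poly_Mapping.single [] (\<Lambda> t)) = 0"
      by (simp add: word_scale_def map_single)
    moreover have "apply_words scaleV act v0 (word [t] - Poly_Mapping.single [] c)
        = act t v0 - scaleV c v0" for c
    proof -
      let ?p = "word [t] - Poly_Mapping.single [] c :: 'a list \<Rightarrow>\<^sub>0 complex"
      \<comment> \<open>The sum is taken over both words rather than over the keys, since the empty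
        word is not a key when \<open>c\<close> = 0.\<close>
      have "apply_words scaleV act v0 ?p
          = (\<Sum>u\<in>{[], [t]}. scaleV (Poly_Mapping.lookup ?p u) (foldr act u v0))"
        unfolding apply_words_def
        by (intro sum.mono_neutral_left)
          (auto simp: in_keys_iff lookup_minus lookup_single when_def split: if_splits)
      then show ?thesis by (simp add: lookup_minus lookup_single)
    qed
    ultimately show ?thesis by simp
  qed
  then show "v0 \<in> weight_space scaleV act H \<Lambda>"
    by (simp add: weight_space_def)
  show "v0 \<noteq> 0" if "irreducible_module scaleV act"
  proof
    assume "v0 = 0"
    then have "range (apply_words scaleV act v0) \<subseteq> {0}"
      by (simp add: image_subset_iff apply_words_zero[OF lm])
    then show False
      using that unfolding gen irreducible_module_def by blast
  qed
qed

theorem theorem3p7: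
  fixes scale :: "complex \<Rightarrow> 'g::ab_group_add \<Rightarrow> 'g"
    and bracket :: "'g \<Rightarrow> 'g \<Rightarrow> 'g"
    and H :: "'g set"
    and \<alpha> \<omega> :: "'r::finite \<Rightarrow> 'g \<Rightarrow> complex"
    and C :: "'r \<Rightarrow> 'r \<Rightarrow> int"
    and d :: "'r \<Rightarrow> nat"
    and e f h :: "'r \<Rightarrow> 'g"
    and form :: "('g \<Rightarrow> complex) \<Rightarrow> ('g \<Rightarrow> complex) \<Rightarrow> complex"
    and \<Lambda> :: "'g \<Rightarrow> complex"
    and scaleV :: "complex \<Rightarrow> 'v::ab_group_add \<Rightarrow> 'v"
    and act :: "'g \<Rightarrow> 'v \<Rightarrow> 'v"
    and v0 :: 'v
    and \<mu> :: "'r \<Rightarrow> complex"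
  assumes "chevalley_data scale bracket H \<alpha> C d e f h form \<omega>"
    and "\<Lambda> \<in> dual_of scale H"
    and "verma_module scale bracket H \<alpha> \<Lambda> scaleV act v0"
    and "generic_weight form \<alpha> \<omega> \<Lambda> scaleV act"
    and "\<forall>i. \<mu> i \<noteq> 0"
  shows "let w = (\<lambda>\<beta>. scaleV (\<Prod>i\<in>UNIV. (of_nat (d i) * \<mu> i) ^ \<beta> i)
                     (Z_vector scaleV act f v0 (vertex_weight form \<alpha> \<omega> \<Lambda>) \<beta>))
         in whittaker_vector scaleV act H \<alpha> e \<Lambda> v0 \<mu> w \<and>
            (\<forall>w'. whittaker_vector scaleV act H \<alpha> e \<Lambda> v0 \<mu> w' \<longrightarrow> w' = w)"
proof -
  interpret chevalley_data scale bracket H \<alpha> C d e f h form \<omega> by (rule assms(1))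
  interpret lie_module scale bracket scaleV act
    using assms(3) by (simp add: verma_module_def)
  have irr: "irreducible_module scaleV act"
    and vw: "\<And>\<beta>. \<beta> \<noteq> 0 \<Longrightarrow> vertex_weight form \<alpha> \<omega> \<Lambda> \<beta> \<noteq> 0"
    using assms(4) by (auto simp: generic_weight_def)
  \<comment> \<open>A hull contains its generators, so the Verma relations for \<open>n_plus\<close>
    give e_i v0 = 0.\<close>
  have "e i \<in> n_plus scale bracket H \<alpha>" for i
    unfolding e_generate[symmetric] by (simp add: hull_inc)
  then interpret irreducible_highest_weight_module scale bracket H \<alpha> C d e f h form \<omega> scaleV act \<Lambda> v0
    using assms(2) irr verma_highest_weight[OF assms(3)] by unfold_locales auto
  show ?thesis
    using whittaker_vector_Z[OF vw] whittaker_vector_unique[OF _ whittaker_vector_Z[OF vw]]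
    by (auto simp: Let_def)
qed

end
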